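(* Assume the setting of the context. For every momentum $k>0$ and all $i,j\in\mathfrak n$, the scattering amplitudes $T^\varepsilon_{ij}(k)$ of $H_\varepsilon$ converge to the scattering amplitudes $T_{ij}(k)$ of the limit operator $H$ as $\varepsilon\to0$; i.e. the on-shell scattering matrix of the pair $(H_\varepsilon,S_0)$ converges to that of $(H,S_0)$, where $S_0=-\frac{\mathrm d^2}{\mathrm dx^2}$ with domain $H^2(\Gamma)\cap K(\Gamma)$.
   Context: Let $\Gamma$ be the star graph consisting of $n$ semi-infinite edges $\gamma_1,\dots,\gamma_n$, each identified with $[0,\infty)$ (parameter $s$), joined at a common vertex $a$ (corresponding to $s=0$ on each edge). A function $\phi$ on $\Gamma$ is a tuple $(\phi_{\gamma_1},\dots,\phi_{\gamma_n})$ of functions on $[0,\infty)$; $L^2(\Gamma)=\bigoplus_i L^2(0,\infty)$, $H^2(\Gamma)=\bigoplus_i H^2(0,\infty)$ (no matching imposed at $a$), $\phi_{\gamma_i}(a):=\phi_{\gamma_i}(0)$ and $\frac{\mathrm d\phi}{\mathrm d\gamma_i}(a):=\phi_{\gamma_i}'(0)$. $K(\Gamma)$ is the set of functions satisfying the Kirchhoff conditions at $a$: $\phi_{\gamma_1}(a)=\dots=\phi_{\gamma_n}(a)$ and $\sum_{i=1}^n\frac{\mathrm d\phi}{\mathrm d\gamma_i}(a)=0$. Fix $a_1,\dots,a_n>0$ and let $\Omega\subset\Gamma$ be the compact star graph with edges $\omega_i=[0,a_i]\subset\gamma_i$; $a_i$ also denotes the endpoint vertex of $\omega_i$, and for a function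 $\psi$ on $\Omega$, $\psi(a_j)$ is the value of $\psi_{\omega_j}$ at $a_j$. $K(\Omega)$ denotes the Kirchhoff conditions at $a$ together with the Neumann conditions $\psi_{\omega_j}'(a_j)=0$, $j=1,\dots,n$. Let $Q\in L^\infty(\Gamma)$ be real-valued with support contained in $\Omega$. Let $\lambda(\cdot)$ be holomorphic near $0$, real for real arguments, with $\lambda(\varepsilon)=1+\varepsilon\lambda+O(\varepsilon^2)$ as $\varepsilon\to0$, $\lambda\in\mathbb R$. For $\varepsilon\in(0,1]$, $H_\varepsilon$ acts as $-\phi''+\lambda(\varepsilon)\varepsilon^{-2}Q(x/\varepsilon)\phi$ on $H^2(\Gamma)\cap K(\Gamma)$. Problem (R): $-\psi''+Q\psi=0$ on $\Omega$, $\psi\in H^2(\Omega)\cap K(\Omega)$; assume it has exactly $m\ge0$ linearly independent solutions, and (after renumbering edges) choose a real basis $\psi_1,\dots,\psi_m$ with $\psi_i(a_j)=\delta_{ij}$, $i,j\le m$. Put $\mathfrak m=\{1,\dots,m\}$, $\mathfrak n=\{1,\dots,n\}$, $\theta_{ij}=\psi_i(a_j)$ ($i\in\mathfrak m$, $j\in\mathfrak n\setminus\mathfrak m$), $q_{ij}=\int_\Omega Q\psi_i\psi_j$ ($i,j\in\mathfrak m$). The limit operator $H$ acts as $-\phi''$ on $\phi\in H^2(\Gamma)$ satisfying $\phi_{\gamma_j}(a)-\sum_{i\in\mathfrak m}\theta_{ij}\phi_{\gamma_i}(a)=0$ for $j\in\mathfrak n\setminus\mathfrak m$ and $\frac{\mathrm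 d\phi}{\mathrm d\gamma_i}(a)+\sum_{j\in\mathfrak n\setminus\mathfrak m}\theta_{ij}\frac{\mathrm d\phi}{\mathrm d\gamma_j}(a)-\lambda\sum_{j\in\mathfrak m}q_{ij}\phi_{\gamma_j}(a)=0$ for $i\in\mathfrak m$. Scattering amplitudes: for $k>0$ and $i\in\mathfrak n$, $T_{ij}=T_{ij}(k)$ are the coefficients such that the function equal to $\delta_{ij}e^{-iks}+T_{ij}e^{iks}$ on $\gamma_j$ ($j\in\mathfrak n$) satisfies the matching conditions of $H$. Similarly, $T^\varepsilon_{ij}$ are the coefficients such that there is a solution of $-\psi''+\lambda(\varepsilon)\varepsilon^{-2}Q(x/\varepsilon)\psi=k^2\psi$ on each edge, locally $H^2$, satisfying the Kirchhoff conditions at $a$, and equal to $\delta_{ij}e^{-iks}+T^\varepsilon_{ij}e^{iks}$ on $\gamma_j$ for $s\ge\varepsilon a_j$. The on-shell scattering matrices are $(T_{ij})$ and $(T^\varepsilon_{ij})$. *)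

theory Defs
  imports "HOL-Analysis.Analysis" "HOL-Library.Landau_Symbols"
begin

text \<open>Edges are indexed by 0,...,n-1; a function on the star graph is a family
  u :: nat => real => _ with u j the function on edge j (parameter s >= 0).\<close>

text \<open>Locally H^2 (strong/weak) solution of  -u'' + V u = E u  on an interval S:
  u is differentiable with derivative u', and u' is absolutely continuous with
  u'' = (V - E) u a.e., i.e. u' t - u' s = integral over [s,t] of (V - E) u.\<close>
definition ode_sol ::
  "(real \<Rightarrow> real) \<Rightarrow> real \<Rightarrow> (real \<Rightarrow> 'a::real_normed_algebra_1) \<Rightarrow> (real \<Rightarrow> 'a) \<Rightarrow> real set \<Rightarrow> bool"
  where "ode_sol V E u u' S \<longleftrightarrow>
    (\<forall>s\<in>S. (u has_vector_derivative u' s) (at s within S)) \<and>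
    (\<forall>s\<in>S. \<forall>t\<in>S. s \<le> t \<longrightarrow>
        (\<lambda>r. of_real (V r - E) * u r) integrable_on {s..t} \<and>
        u' t - u' s = integral {s..t} (\<lambda>r. of_real (V r - E) * u r))"

definition solR :: "nat \<Rightarrow> (nat \<Rightarrow> real) \<Rightarrow> (nat \<Rightarrow> real \<Rightarrow> real) \<Rightarrow> (nat \<Rightarrow> real \<Rightarrow> real) \<Rightarrow> bool"
  where "solR n a Q psi \<longleftrightarrow> (\<exists>psi'.
     (\<forall>l<n. ode_sol (Q l) 0 (psi l) (psi' l) {0..a l}) \<and>
     (\<forall>l<n. \<forall>l'<n. psi l 0 = psi l' 0) \<and>
     (\<Sum>l<n. psi' l 0) = 0 \<and>
     (\<forall>l<n. psi' l (a l) = 0))"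

definition theta :: "(nat \<Rightarrow> real) \<Rightarrow> (nat \<Rightarrow> nat \<Rightarrow> real \<Rightarrow> real) \<Rightarrow> nat \<Rightarrow> nat \<Rightarrow> real"
  where "theta a psi i j = psi i j (a j)"

definition qmat :: "nat \<Rightarrow> (nat \<Rightarrow> real) \<Rightarrow> (nat \<Rightarrow> real \<Rightarrow> real) \<Rightarrow> (nat \<Rightarrow> nat \<Rightarrow> real \<Rightarrow> real) \<Rightarrow> nat \<Rightarrow> nat \<Rightarrow> real"
  where "qmat n a Q psi i j = (\<Sum>l<n. integral {0..a l} (\<lambda>s. Q l s * psi i l s * psi j l s))"

text \<open>t (a row (T_{ij})_j, padded by 0 for j >= n) are scattering amplitudes of H_eps
  at momentum k for incoming edge i.\<close>
definition Teps_prop :: "nat \<Rightarrow> (nat \<Rightarrow> real) \<Rightarrow> (nat \<Rightarrow> real \<Rightarrow> real) \<Rightarrow> (real \<Rightarrow> real)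
    \<Rightarrow> real \<Rightarrow> real \<Rightarrow> nat \<Rightarrow> (nat \<Rightarrow> complex) \<Rightarrow> bool"
  where "Teps_prop n a Q lamf eps k i t \<longleftrightarrow>
    (\<forall>j\<ge>n. t j = 0) \<and>
    (\<exists>(u :: nat \<Rightarrow> real \<Rightarrow> complex) u'.
       (\<forall>j<n. ode_sol (\<lambda>s. lamf eps / eps\<^sup>2 * Q j (s / eps)) (k\<^sup>2) (u j) (u' j) {0..}) \<and>
       (\<forall>j<n. \<forall>j'<n. u j 0 = u j' 0) \<and>
       (\<Sum>j<n. u' j 0) = 0 \<and>
       (\<forall>j<n. \<forall>s\<ge>eps * a j.
          u j s = (if i = j then exp (- \<i> * of_real (k * s)) else 0) + t j * exp (\<i> * of_real (k * s))))"

text \<open>t are scattering amplitudes of the limit operator H at momentum k for incoming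
  edge i: the function delta_{ij} e^{-iks} + t_j e^{iks} on edge j satisfies the
  matching conditions of H. Edges 0..m-1 play the role of the set m.\<close>
definition Tlim_prop :: "nat \<Rightarrow> nat \<Rightarrow> (nat \<Rightarrow> nat \<Rightarrow> real) \<Rightarrow> (nat \<Rightarrow> nat \<Rightarrow> real) \<Rightarrow> real
    \<Rightarrow> real \<Rightarrow> nat \<Rightarrow> (nat \<Rightarrow> complex) \<Rightarrow> bool"
  where "Tlim_prop n m th q lam k i t \<longleftrightarrow>
    (let phi0 = (\<lambda>j. (if i = j then 1 else 0) + t j);
         phi1 = (\<lambda>j. \<i> * of_real k * (t j - (if i = j then 1 else 0)))
     in (\<forall>j\<ge>n. t j = 0) \<and>
        (\<forall>j\<in>{m..<n}. phi0 j - (\<Sum>i'<m. of_real (th i' j) * phi0 i') = 0) \<and>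
        (\<forall>i'<m. phi1 i' + (\<Sum>j\<in>{m..<n}. of_real (th i' j) * phi1 j)
                 - of_real lam * (\<Sum>j<m. of_real (q i' j) * phi0 j) = 0))"

end

theory Submission
  imports Defs
begin

text \<open>On each edge, the flux \<open>Im (cnj u * u')\<close> of a solution is constant, and the Kirchhoff conditions
  make the fluxes at the vertex cancel. Hence the scattering amplitudes of \<open>H\<^sub>\<epsilon>\<close> are unique and
  satisfy \<open>\<Sum>j. \<bar>t j\<bar>\<^sup>2 = 1\<close>. By compactness it suffices to show that every limit point as
  \<open>\<epsilon> \<longrightarrow> 0\<close> solves the matching problem of \<open>H\<close>, which has at most one solution because \<open>k > 0\<close>
  and \<open>q\<close> is symmetric; this also yields its solvability. In the variable \<open>s / \<epsilon>\<close> the scattering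
  solutions solve \<open>- v'' + \<lambda>(\<epsilon>) Q v = \<epsilon>\<^sup>2 k\<^sup>2 v\<close> with \<open>v' = O(\<epsilon>)\<close> at the endpoints, so they
  converge on \<open>\<Omega>\<close> to a solution of (R). This is the first matching condition. Green's identity
  with \<open>psi i\<close>, divided by \<open>\<epsilon>\<close>, gives the second one in the limit.\<close>

section \<open>Linear equations with bounded coefficients\<close>

text \<open>\<open>Q\<close> is only bounded and measurable, so solutions have second derivatives
  merely almost everywhere; well-posedness, the product rule and Green's identity are therefore
  established for integrated equations. What is explicitly known about a scattering solution sits at
  the outer end of the potential, where it is a plane wave, while the vertex only couples the edges.
  Each edge is thus solved inwards from its outer end, and existence and stability are stated as
  terminal value problems. The coupling \<open>lam * q\<close> originates in Green's identity with
  \<open>psi i\<close>. The vertex terms cancel by the two Kirchhoff conditions, the Neumann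
  conditions leave only the outer derivatives of \<open>v\<close>, which are of order \<epsilon>,
  and the volume terms are \<open>\<lambda>(\<epsilon>) - 1\<close> times the integral of
  \<open>Q v psi i\<close> minus \<open>\<epsilon>\<^sup>2 k\<^sup>2\<close> times that of
  \<open>v psi i\<close>. After division by \<epsilon> the first prefactor tends to
  \<open>lam\<close> and the second to 0. Since \<open>psi i\<close> equals 1 at its own endpoint
  and 0 at the others among the first \<open>m\<close>, coordinates in (R) are endpoint values; this
  produces \<open>theta\<close>.\<close>

lemma has_integral_exp_weight:
  fixes L b t :: real
  assumes "L > 0" "t \<le> b"
  shows "((\<lambda>r. exp (L * (b - r))) has_integral (exp (L * (b - t)) - 1) / L) {t..b}"
proof -
  have "((\<lambda>r. exp (L * (b - r))) has_integral (- exp (L * (b - b)) / L - (- exp (L * (b - t)) / L))) {t..b}"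
    using assms
    by (intro fundamental_theorem_of_calculus)
       (auto intro!: derivative_eq_intros simp flip: has_real_derivative_iff_has_vector_derivative)
  then show ?thesis
    by (simp add: diff_divide_distrib)
qed

text \<open>Integrating the weight towards \<open>b\<close> reproduces it with a gain of
  \<open>1 / L\<close>. This gain gives both the contraction and the absorption in the stability
  estimate; a constant error \<open>D\<close> costs at most the length of the interval.\<close>

lemma exp_weight_bound:
  fixes L b t C D :: real and f :: "real \<Rightarrow> 'b::banach"
  assumes L: "L > 0" and t: "0 \<le> t" "t \<le> b" and C: "C \<ge> 0" and D: "D \<ge> 0"
    and f: "f integrable_on {0..b}"
    and le: "\<And>r. r \<in> {0..b} \<Longrightarrow> norm (f r) \<le> C * exp (L * (b - r)) + D"
  shows "norm (integral {t..b} f) \<le> C / L * exp (L * (b - t)) + b * D"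
proof -
  let ?w = "\<lambda>r. C * exp (L * (b - r)) + D"
  have w: "(?w has_integral C * ((exp (L * (b - t)) - 1) / L) + (b - t) * D) {t..b}"
    using has_integral_add[OF has_integral_mult_right[OF has_integral_exp_weight[OF L t(2)], of C]
        has_integral_const_real[of D t b]] t by (simp add: content_real)
  have "norm (integral {t..b} f) \<le> integral {t..b} ?w"
  proof (rule integral_norm_bound_integral)
    show "f integrable_on {t..b}"
      using f t by (auto intro: integrable_subinterval_real)
    show "?w integrable_on {t..b}"
      using w by blast
  qed (use le t in auto)
  also have "\<dots> = C * ((exp (L * (b - t)) - 1) / L) + (b - t) * D"
    using w by (rule integral_unique)
  also have "C * ((exp (L * (b - t)) - 1) / L) \<le> C / L * exp (L * (b - t))"
    using L C by (simp add: field_simps)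
  also have "(b - t) * D \<le> b * D"
    using t D by (intro mult_right_mono) auto
  finally show ?thesis by simp
qed

text \<open>Bielecki's argument: in the weighted norm \<open>sup exp (- L (b - t)) |x t|\<close> the Picard
  operator contracts on the whole interval once \<open>L\<close> exceeds the Lipschitz constant.\<close>

lemma terminal_value_exists:
  fixes F :: "real \<Rightarrow> 'b::banach \<Rightarrow> 'b"
  assumes b: "0 \<le> b" and K: "0 \<le> K"
    and lip: "\<And>t x y. t \<in> {0..b} \<Longrightarrow> norm (F t x - F t y) \<le> K * norm (x - y)"
    and int: "\<And>x. continuous_on {0..b} x \<Longrightarrow> (\<lambda>t. F t (x t)) integrable_on {0..b}"
  obtains x where "continuous_on {0..b} x"
    and "\<And>t. t \<in> {0..b} \<Longrightarrow> x t = p - integral {t..b} (\<lambda>r. F r (x r))"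
proof -
  \<comment> \<open>The contraction factor will be \<open>K / L\<close>, which is at most 1/2; the
    summand 1 keeps \<open>L\<close> positive when \<open>K = 0\<close>.\<close>
  define L where "L = 2 * K + 1"
  have L: "L > 0" using K by (simp add: L_def)
  \<comment> \<open>Bounded continuous functions live on the whole line, so functions on
    \<open>{0..b}\<close> are extended by constants through the clamp \<open>c\<close>.\<close>
  define c :: "real \<Rightarrow> real" where "c = (\<lambda>t. max 0 (min b t))"
  have c: "c t \<in> {0..b}" for t using b by (auto simp: c_def)
  have c_id: "c t = t" if "t \<in> {0..b}" for t using that by (auto simp: c_def)
  \<comment> \<open>The unknown is rescaled to \<open>v t = exp (- L (b - t)) x t\<close>. The plain
    supremum distance of \<open>v\<close> is then the weighted distance of \<open>x\<close>, and
    \<open>G\<close> is the Picard operator conjugated by the weight.\<close>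
  define g where "g v r = F r (exp (L * (b - r)) *\<^sub>R v r)" for v r
  define G where "G v t = exp (- (L * (b - t))) *\<^sub>R (p - integral {t..b} (g v))" for v t
  have g_int: "g (apply_bcontfun v) integrable_on {0..b}" for v
    unfolding g_def
    by (rule int) (auto intro!: continuous_intros)
  have G_cont: "continuous_on {0..b} (G (apply_bcontfun v))" for v
    unfolding G_def
    by (intro continuous_intros indefinite_integral_continuous_1' g_int)
  define T where "T v = Bcontfun (\<lambda>t. G (apply_bcontfun v) (c t))" for v
  have T: "apply_bcontfun (T v) = (\<lambda>t. G (apply_bcontfun v) (c t))" for v
  proof -
    have "continuous_on UNIV (\<lambda>t. G (apply_bcontfun v) (c t))"
      by (rule continuous_on_compose2[OF G_cont]) (use c in \<open>auto simp: c_def intro!: continuous_intros\<close>)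
    moreover have "bounded (range (\<lambda>t. G (apply_bcontfun v) (c t)))"
      by (rule bounded_subset[OF compact_imp_bounded[OF compact_continuous_image[OF G_cont compact_Icc]]])
         (use c in auto)
    ultimately show ?thesis
      unfolding T_def by (intro Bcontfun_inverse) (auto simp: bcontfun_def)
  qed
  have contract: "dist (T v) (T w) \<le> 1/2 * dist v w" for v w
  proof (rule dist_bound)
    fix t
    define s where "s = c t"
    have s: "0 \<le> s" "s \<le> b" using c[of t] by (auto simp: s_def)
    have int_eq: "integral {s..b} (g v) - integral {s..b} (g w) = integral {s..b} (\<lambda>r. g v r - g w r)"
      using s by (intro integral_diff[symmetric] integrable_subinterval_real[OF g_int]) auto
    have bd: "norm (integral {s..b} (\<lambda>r. g v r - g w r)) \<le> (K * dist v w) / L * exp (L * (b - s)) + b * 0"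
    proof (rule exp_weight_bound[OF L s])
      fix r assume r: "r \<in> {0..b}"
      have "norm (g v r - g w r) \<le> K * norm (exp (L * (b - r)) *\<^sub>R v r - exp (L * (b - r)) *\<^sub>R w r)"
        unfolding g_def by (rule lip[OF r])
      also have "\<dots> = K * (exp (L * (b - r)) * dist (v r) (w r))"
        by (simp add: dist_norm flip: scaleR_diff_right)
      also have "\<dots> \<le> K * (exp (L * (b - r)) * dist v w)"
        by (intro mult_left_mono dist_bounded K) auto
      finally show "norm (g v r - g w r) \<le> K * dist v w * exp (L * (b - r)) + 0"
        by (simp add: mult_ac)
    qed (use K g_int in \<open>auto intro!: integrable_diff\<close>)
    have "dist (T v t) (T w t) = exp (- (L * (b - s))) * norm (integral {s..b} (g v) - integral {s..b} (g w))"
      by (simp add: T G_def dist_norm s_def norm_minus_commute flip: scaleR_diff_right)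
    also have "\<dots> \<le> exp (- (L * (b - s))) * ((K * dist v w) / L * exp (L * (b - s)) + b * 0)"
      unfolding int_eq by (intro mult_left_mono bd) auto
    also have "\<dots> = K / L * dist v w * (exp (- (L * (b - s))) * exp (L * (b - s)))"
      by simp
    also have "exp (- (L * (b - s))) * exp (L * (b - s)) = 1"
      by (simp flip: exp_add)
    also have "K / L * dist v w * 1 = K / L * dist v w"
      by simp
    also have "\<dots> \<le> 1/2 * dist v w"
      using K by (intro mult_right_mono) (auto simp: L_def field_simps)
    finally show "dist (T v t) (T w t) \<le> 1/2 * dist v w" .
  qed
  then obtain v where v: "T v = v"
    using banach_fix_type[of "1/2" T] by auto
  define x where "x t = exp (L * (b - t)) *\<^sub>R v t" for t
  have "continuous_on {0..b} x"
    unfolding x_def by (intro continuous_intros) auto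
  moreover have "x t = p - integral {t..b} (\<lambda>r. F r (x r))" if t: "t \<in> {0..b}" for t
  proof -
    have "v t = G v t"
      using T[of v] c_id[OF t] v by metis
    then have "x t = p - integral {t..b} (g v)"
      unfolding x_def G_def by (simp add: exp_minus)
    then show ?thesis
      by (simp add: g_def[abs_def] x_def[abs_def])
  qed
  ultimately show thesis by (rule that)
qed

text \<open>A Gronwall estimate by the same weight. The weighted difference attains its maximum, and
  there the integral inequality bounds it by the data plus half of itself, because
  \<open>L = 2 * K\<close>. Absorbing that half yields the factor 2, removing the weight yields the
  exponential.\<close>

lemma terminal_value_stability:
  fixes x y :: "real \<Rightarrow> 'b::banach"
  assumes b: "0 \<le> b" and K: "0 < K" and \<delta>: "0 \<le> \<delta>"
    and x: "continuous_on {0..b} x" "\<And>t. t \<in> {0..b} \<Longrightarrow> x t = p - integral {t..b} f"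
    and y: "continuous_on {0..b} y" "\<And>t. t \<in> {0..b} \<Longrightarrow> y t = q - integral {t..b} g"
    and f: "f integrable_on {0..b}" and g: "g integrable_on {0..b}"
    and le: "\<And>r. r \<in> {0..b} \<Longrightarrow> norm (f r - g r) \<le> K * norm (x r - y r) + \<delta>"
    and t: "t \<in> {0..b}"
  shows "norm (x t - y t) \<le> 2 * exp (2 * K * b) * (norm (p - q) + b * \<delta>)"
proof -
  define L where "L = 2 * K"
  have L: "L > 0" using K by (simp add: L_def)
  define h where "h t = exp (- (L * (b - t))) * norm (x t - y t)" for t
  have "continuous_on {0..b} h"
    unfolding h_def by (intro continuous_intros x y)
  then obtain t0 where t0: "t0 \<in> {0..b}" and max: "\<And>t. t \<in> {0..b} \<Longrightarrow> h t \<le> h t0"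
    using continuous_attains_sup[of "{0..b}" h] b by auto
  have hx: "norm (x t - y t) \<le> h t0 * exp (L * (b - t))" if "t \<in> {0..b}" for t
  proof -
    have "norm (x t - y t) = h t * exp (L * (b - t))"
      by (simp add: h_def exp_minus)
    then show ?thesis
      using max[OF that] by (simp add: mult_right_mono)
  qed
  have h0: "h t0 \<ge> 0" by (simp add: h_def)
  have "norm (x t0 - y t0) = norm ((p - q) - integral {t0..b} (\<lambda>r. f r - g r))"
    using x(2)[OF t0] y(2)[OF t0] f g t0
    by (subst integral_diff) (auto intro: integrable_subinterval_real simp: algebra_simps)
  also have "\<dots> \<le> norm (p - q) + norm (integral {t0..b} (\<lambda>r. f r - g r))"
    by (rule norm_triangle_ineq4)
  also have "norm (integral {t0..b} (\<lambda>r. f r - g r)) \<le> (K * h t0) / L * exp (L * (b - t0)) + b * \<delta>"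
  proof (rule exp_weight_bound[OF L])
    fix r assume r: "r \<in> {0..b}"
    show "norm (f r - g r) \<le> K * h t0 * exp (L * (b - r)) + \<delta>"
      using le[OF r] mult_left_mono[OF hx[OF r] less_imp_le[OF K]] by (simp add: mult_ac)
  qed (use t0 K h0 \<delta> f g in \<open>auto intro!: integrable_diff\<close>)
  finally have *: "norm (x t0 - y t0) \<le> norm (p - q) + h t0 / 2 * exp (L * (b - t0)) + b * \<delta>"
    using K by (simp add: L_def)
  have "h t0 = exp (- (L * (b - t0))) * norm (x t0 - y t0)"
    by (rule h_def)
  also have "\<dots> \<le> exp (- (L * (b - t0))) * (norm (p - q) + h t0 / 2 * exp (L * (b - t0)) + b * \<delta>)"
    using * by (intro mult_left_mono) auto
  also have "\<dots> = exp (- (L * (b - t0))) * (norm (p - q) + b * \<delta>)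
      + h t0 / 2 * (exp (- (L * (b - t0))) * exp (L * (b - t0)))"
    by (simp add: distrib_left mult_ac)
  also have "exp (- (L * (b - t0))) * exp (L * (b - t0)) = 1"
    by (simp flip: exp_add)
  also have "exp (- (L * (b - t0))) * (norm (p - q) + b * \<delta>) \<le> 1 * (norm (p - q) + b * \<delta>)"
    using t0 L b \<delta> by (intro mult_right_mono) auto
  finally have h2: "h t0 \<le> 2 * (norm (p - q) + b * \<delta>)"
    by simp
  have "norm (x t - y t) \<le> h t0 * exp (L * (b - t))"
    by (rule hx[OF t])
  also have "h t0 * exp (L * (b - t)) \<le> 2 * (norm (p - q) + b * \<delta>) * exp (L * b)"
    using h2 t L h0 by (intro mult_mono) auto
  also have "\<dots> = 2 * exp (2 * K * b) * (norm (p - q) + b * \<delta>)"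
    by (simp add: L_def)
  finally show ?thesis .
qed

lemma has_integral_Pair:
  fixes f :: "'n::euclidean_space \<Rightarrow> 'a::real_normed_vector" and g :: "'n \<Rightarrow> 'b::real_normed_vector"
  assumes "(f has_integral x) S" "(g has_integral y) S"
  shows "((\<lambda>r. (f r, g r)) has_integral (x, y)) S"
proof -
  have 1: "bounded_linear (\<lambda>x::'a. (x, 0::'b))"
    by (intro bounded_linear_Pair bounded_linear_ident bounded_linear_zero)
  have 2: "bounded_linear (\<lambda>y::'b. (0::'a, y))"
    by (intro bounded_linear_Pair bounded_linear_ident bounded_linear_zero)
  show ?thesis
    using has_integral_add[OF has_integral_linear[OF assms(1) 1] has_integral_linear[OF assms(2) 2]]
    by (simp add: o_def)
qed

text \<open>Difference quotients are at most \<open>K\<close> times the increment of the argument,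
  so the derivative within the interval vanishes everywhere, including the endpoints.\<close>

lemma constant_if_quadratic_increments:
  fixes F :: "real \<Rightarrow> 'a::real_normed_vector"
  assumes K: "K \<ge> 0"
    and le: "\<And>s t. a \<le> s \<Longrightarrow> s \<le> t \<Longrightarrow> t \<le> b \<Longrightarrow> norm (F t - F s) \<le> K * (t - s)\<^sup>2"
    and t: "t \<in> {a..b}"
  shows "F t = F a"
proof -
  have le': "norm (F t - F s) \<le> K * \<bar>t - s\<bar>\<^sup>2" if "s \<in> {a..b}" "t \<in> {a..b}" for s t
  proof (cases "s \<le> t")
    case False
    then show ?thesis
      using le[of t s] that by (simp add: norm_minus_commute power2_commute)
  qed (use le[of s t] that in simp)
  have "\<exists>c. \<forall>x\<in>{a..b}. F x = c"
  proof (rule has_derivative_zero_constant)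
    fix x assume x: "x \<in> {a..b}"
    show "(F has_derivative (\<lambda>h. 0)) (at x within {a..b})"
      unfolding has_derivative_within_alt
    proof (intro conjI allI impI)
      fix e :: real assume e: "e > 0"
      have "norm (F y - F x - 0) \<le> e * norm (y - x)"
        if y: "y \<in> {a..b}" and d: "norm (y - x) < e / (K + 1)" for y
      proof -
        have "norm (F y - F x) \<le> (K * \<bar>y - x\<bar>) * \<bar>y - x\<bar>"
          using le'[OF x y] by (simp add: power2_eq_square mult_ac)
        also have "\<dots> \<le> e * \<bar>y - x\<bar>"
        proof (rule mult_right_mono)
          have "K * \<bar>y - x\<bar> \<le> (K + 1) * \<bar>y - x\<bar>"
            by (simp add: mult_right_mono)
          also have "\<dots> \<le> e"
            using d K by (simp add: field_simps)
          finally show "K * \<bar>y - x\<bar> \<le> e" .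
        qed simp
        finally show ?thesis by simp
      qed
      then show "\<exists>d>0. \<forall>y\<in>{a..b}. norm (y - x) < d \<longrightarrow> norm (F y - F x - 0) \<le> e * norm (y - x)"
        using e K by (intro exI[of _ "e / (K + 1)"]) auto
    qed simp
  qed simp
  then show ?thesis using t by force
qed

text \<open>Over an interval of length \<open>h\<close>, freezing one factor of each product changes the integral by
  \<open>O(h\<^sup>2)\<close>, so the two sides differ by a function with zero derivative; \<open>f\<close> and \<open>g\<close> need
  not be continuous.\<close>

lemma has_integral_product_rule:
  fixes A B f g :: "real \<Rightarrow> 'a::{banach, real_normed_algebra}"
  assumes ab: "a \<le> b"
    and f: "\<And>s t. a \<le> s \<Longrightarrow> s \<le> t \<Longrightarrow> t \<le> b \<Longrightarrow> (f has_integral A t - A s) {s..t}"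
    and g: "\<And>s t. a \<le> s \<Longrightarrow> s \<le> t \<Longrightarrow> t \<le> b \<Longrightarrow> (g has_integral B t - B s) {s..t}"
    and C: "\<And>r. r \<in> {a..b} \<Longrightarrow> norm (f r) \<le> C" "\<And>r. r \<in> {a..b} \<Longrightarrow> norm (g r) \<le> C"
    and int: "(\<lambda>r. f r * B r) integrable_on {a..b}" "(\<lambda>r. A r * g r) integrable_on {a..b}"
  shows "((\<lambda>r. f r * B r + A r * g r) has_integral (A b * B b - A a * B a)) {a..b}"
proof -
  let ?h = "\<lambda>r. f r * B r + A r * g r"
  have C0: "C \<ge> 0" using order_trans[OF norm_ge_zero C(1)[of a]] ab by simp
  have h: "?h integrable_on {s..t}" if "a \<le> s" "t \<le> b" for s t
    by (rule integrable_subinterval_real[OF integrable_add[OF int]]) (use that in auto)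
  have lip: "norm (H t - H s) \<le> C * (t - s)"
    if "a \<le> s" "s \<le> t" "t \<le> b" "(h has_integral H t - H s) {s..t}"
       "\<And>r. r \<in> {a..b} \<Longrightarrow> norm (h r) \<le> C" for h H :: "real \<Rightarrow> 'a" and s t
    using has_integral_bound[OF C0, where f = h and i = "H t - H s" and a = s and b = t] that by (simp add: content_real)
  define F where "F t = A t * B t - integral {a..t} ?h" for t
  have "F b = F a"
  proof (rule constant_if_quadratic_increments)
    fix s t assume st: "a \<le> s" "s \<le> t" "t \<le> b"
    have "((\<lambda>r. f r * B t + A s * g r) has_integral (A t - A s) * B t + A s * (B t - B s)) {s..t}"
      by (intro has_integral_add has_integral_mult_left has_integral_mult_right f g st)
    moreover have "(A t - A s) * B t + A s * (B t - B s) = A t * B t - A s * B s"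
      by (simp add: algebra_simps)
    ultimately have "((\<lambda>r. f r * B t + A s * g r - ?h r) has_integral
        A t * B t - A s * B s - integral {s..t} ?h) {s..t}"
      using h[of s t] st by (intro has_integral_diff) (auto simp: has_integral_integral)
    moreover have "integral {s..t} ?h = integral {a..t} ?h - integral {a..s} ?h"
      using Henstock_Kurzweil_Integration.integral_combine[where a = a and c = s and b = t and f = ?h]
        h[of a t] st by (simp add: eq_diff_eq add.commute)
    then have "A t * B t - A s * B s - integral {s..t} ?h = F t - F s"
      unfolding F_def by (simp only:) (simp add: algebra_simps)
    ultimately have "((\<lambda>r. f r * B t + A s * g r - ?h r) has_integral F t - F s) {s..t}"
      by (simp only:)
    then have "norm (F t - F s) \<le> (2 * C\<^sup>2 * (t - s)) * measure lborel (cbox s t)"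
    proof (intro has_integral_bound)
      fix r assume "r \<in> cbox s t"
      then have r: "s \<le> r" "r \<le> t" by auto
      have "f r * B t + A s * g r - ?h r = f r * (B t - B r) - (A r - A s) * g r"
        by (simp add: algebra_simps)
      also have "norm \<dots> \<le> norm (f r) * norm (B t - B r) + norm (A r - A s) * norm (g r)"
        by (intro order_trans[OF norm_triangle_ineq4] add_mono norm_mult_ineq)
      also have "\<dots> \<le> C * (C * (t - r)) + (C * (r - s)) * C"
        using r st C0 by (intro add_mono mult_mono C lip[where s=r and t=t and h=g and H=B] lip[where s=s and t=r and h=f and H=A] f g) auto
      also have "\<dots> \<le> 2 * C\<^sup>2 * (t - s)"
        using r C0 by (simp add: algebra_simps power2_eq_square mult_left_mono)
      finally show "norm (f r * B t + A s * g r - ?h r) \<le> 2 * C\<^sup>2 * (t - s)" .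
    qed (use C0 st in auto)
    then show "norm (F t - F s) \<le> (2 * C\<^sup>2) * (t - s)\<^sup>2"
      using st by (simp add: content_real power2_eq_square mult_ac)
  qed (use ab in auto)
  then have "integral {a..b} ?h = A b * B b - A a * B a"
    by (simp add: F_def algebra_simps)
  then show ?thesis
    using h[of a b] by (auto simp: has_integral_iff)
qed

section \<open>One-dimensional Schroedinger equations\<close>

text \<open>The bound holds at every point rather than almost everywhere, so that later estimates
  carry no exceptional sets.\<close>

definition bounded_potential :: "(real \<Rightarrow> real) \<Rightarrow> bool" where
  "bounded_potential V \<longleftrightarrow> V \<in> borel_measurable borel \<and> bounded (range V)"

lemma bounded_potential_rescale:
  assumes "bounded_potential V"
  shows "bounded_potential (\<lambda>s. c * V (s / d))"
proof -
  obtain B where "\<And>r. \<bar>V r\<bar> \<le> B"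
    using assms by (auto simp: bounded_potential_def bounded_iff)
  then have "\<bar>c * V (s / d)\<bar> \<le> \<bar>c\<bar> * B" for s
    by (simp add: abs_mult mult_left_mono)
  then have "bounded (range (\<lambda>s. c * V (s / d)))"
    unfolding bounded_iff by auto
  moreover have [measurable]: "V \<in> borel_measurable borel"
    using assms by (simp add: bounded_potential_def)
  have "(\<lambda>s. c * V (s / d)) \<in> borel_measurable borel"
    by measurable
  ultimately show ?thesis
    by (simp add: bounded_potential_def)
qed

lemma bounded_potential_cmult: "bounded_potential V \<Longrightarrow> bounded_potential (\<lambda>s. c * V s)"
  using bounded_potential_rescale[of V c 1] by simp

lemma bounded_potential_diff:
  assumes "bounded_potential V"
  shows "bounded_potential (\<lambda>s. V s - E)"
proof -
  obtain B where "\<And>r. \<bar>V r\<bar> \<le> B"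
    using assms by (auto simp: bounded_potential_def bounded_iff)
  then have "\<bar>V s - E\<bar> \<le> B + \<bar>E\<bar>" for s
    using abs_triangle_ineq4[of "V s" E] by (meson add_right_mono order_trans)
  then have "bounded (range (\<lambda>s. V s - E))"
    unfolding bounded_iff by auto
  moreover have [measurable]: "V \<in> borel_measurable borel"
    using assms by (simp add: bounded_potential_def)
  have "(\<lambda>s. V s - E) \<in> borel_measurable borel"
    by measurable
  ultimately show ?thesis
    by (simp add: bounded_potential_def)
qed

lemma bounded_potential_integrable:
  fixes u :: "real \<Rightarrow> complex"
  assumes V: "bounded_potential V" and u: "continuous_on {s..t} u"
  shows "(\<lambda>r. of_real (V r - E) * u r) integrable_on {s..t}"
proof -
  have V': "bounded_potential (\<lambda>r. V r - E)"
    by (rule bounded_potential_diff[OF V])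
  have "(\<lambda>r. (V r - E) *\<^sub>R u r) absolutely_integrable_on {s..t}"
  proof (rule absolutely_integrable_bounded_measurable_product[where h = "(*\<^sub>R)" and f = "\<lambda>r. V r - E" and g = u])
    show "bilinear ((*\<^sub>R) :: real \<Rightarrow> complex \<Rightarrow> complex)"
      by (simp add: bilinear_conv_bounded_bilinear bounded_bilinear_scaleR)
    show "(\<lambda>r. V r - E) \<in> borel_measurable (lebesgue_on {s..t})"
      using V' by (auto simp: bounded_potential_def intro!: measurable_restrict_space1 measurable_completion)
    show "bounded ((\<lambda>r. V r - E) ` {s..t})"
      using V' by (auto simp: bounded_potential_def intro: bounded_subset)
    show "u absolutely_integrable_on {s..t}"
      by (rule absolutely_integrable_continuous_real[OF u])
  qed simp
  then show ?thesis
    by (auto simp: absolutely_integrable_on_def scaleR_conv_of_real)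
qed

lemma ode_sol_subset: "ode_sol V E u u' S \<Longrightarrow> T \<subseteq> S \<Longrightarrow> ode_sol V E u u' T"
  unfolding ode_sol_def by (blast intro: has_vector_derivative_within_subset)

lemma ode_sol_has_vector_derivative:
  "ode_sol V E u u' S \<Longrightarrow> s \<in> S \<Longrightarrow> (u has_vector_derivative u' s) (at s within S)"
  by (simp add: ode_sol_def)

lemma ode_sol_continuous: "ode_sol V E u u' S \<Longrightarrow> continuous_on S u"
  by (auto simp: continuous_on_eq_continuous_within ode_sol_def intro: has_vector_derivative_continuous)

lemma ode_sol_has_integral:
  assumes "ode_sol V E u u' S" "s \<in> S" "t \<in> S" "s \<le> t"
  shows "((\<lambda>r. of_real (V r - E) * u r) has_integral (u' t - u' s)) {s..t}"
  using assms by (auto simp: ode_sol_def has_integral_iff)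

lemma ode_sol_has_integral':
  fixes u :: "real \<Rightarrow> 'a::{banach, real_normed_algebra_1}"
  assumes "ode_sol V E u u' S" "{s..t} \<subseteq> S" "s \<le> t"
  shows "(u' has_integral (u t - u s)) {s..t}"
  using assms(3) ode_sol_has_vector_derivative[OF ode_sol_subset[OF assms(1,2)]]
  by (intro fundamental_theorem_of_calculus)

text \<open>The definition prescribes only increments of \<open>u'\<close>; they make
  \<open>u'\<close> an indefinite integral, which is continuous.\<close>

lemma ode_sol_continuous':
  fixes u :: "real \<Rightarrow> 'a::{banach, real_normed_algebra_1}"
  assumes u: "ode_sol V E u u' {a..b}"
  shows "continuous_on {a..b} u'"
proof (cases "a \<le> b")
  case True
  let ?f = "\<lambda>r. of_real (V r - E) * u r"
  have "continuous_on {a..b} (\<lambda>t. u' a + integral {a..t} ?f)"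
    using ode_sol_has_integral[OF u, of a b] True
    by (intro continuous_intros indefinite_integral_continuous_1) auto
  moreover have "u' a + integral {a..t} ?f = u' t" if "t \<in> {a..b}" for t
    using integral_unique[OF ode_sol_has_integral[OF u, of a t]] that by auto
  ultimately show ?thesis
    using continuous_on_eq by blast
qed simp

text \<open>The coefficient is real, so the equation commutes with every real-linear map:
  conjugation, real and imaginary part, the embedding of the reals, and multiplication by a complex
  constant.\<close>

lemma ode_sol_bounded_linear:
  fixes h :: "'a::{banach,real_normed_algebra_1} \<Rightarrow> 'b::{banach,real_normed_algebra_1}"
  assumes u: "ode_sol V E u u' S" and h: "bounded_linear h"
  shows "ode_sol V E (\<lambda>s. h (u s)) (\<lambda>s. h (u' s)) S"
proof -
  interpret h: bounded_linear h by (rule h)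
  have "((\<lambda>r. of_real (V r - E) * h (u r)) has_integral (h (u' t) - h (u' s))) {s..t}"
    if "s \<in> S" "t \<in> S" "s \<le> t" for s t
    using has_integral_linear[OF ode_sol_has_integral[OF u that] h]
    by (simp add: o_def h.diff h.scaleR flip: scaleR_conv_of_real del: of_real_diff)
  then show ?thesis
    using u by (auto simp: ode_sol_def has_integral_iff intro: h.has_vector_derivative)
qed

text \<open>The product rule for \<open>u' * w\<close>. The test function \<open>w\<close> needs
  only a continuous derivative; Green's identity and flux conservation come from different choices
  of it.\<close>

lemma ode_sol_weak_form:
  fixes u w :: "real \<Rightarrow> complex"
  assumes b: "0 \<le> b" and V: "bounded_potential V" and u: "ode_sol V E u u' {0..b}"
    and w: "\<And>s. s \<in> {0..b} \<Longrightarrow> (w has_vector_derivative w' s) (at s within {0..b})"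
    and w': "continuous_on {0..b} w'"
  shows "((\<lambda>r. of_real (V r - E) * u r * w r + u' r * w' r) has_integral (u' b * w b - u' 0 * w 0)) {0..b}"
proof -
  have wc: "continuous_on {0..b} w"
    unfolding continuous_on_eq_continuous_within
    using has_vector_derivative_continuous[OF w] by blast
  have uc: "continuous_on {0..b} u" "continuous_on {0..b} u'"
    using ode_sol_continuous[OF u] ode_sol_continuous'[OF u] by auto
  obtain C1 where C1: "\<And>r. \<bar>V r - E\<bar> \<le> C1"
    using bounded_potential_diff[OF V, of E] by (auto simp: bounded_potential_def bounded_iff)
  have "bounded (u ` {0..b})" "bounded (w' ` {0..b})"
    using uc w' by (auto intro!: compact_imp_bounded compact_continuous_image)
  then obtain C2 C3 where C2: "\<And>r. r \<in> {0..b} \<Longrightarrow> norm (u r) \<le> C2" 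
    and C3: "\<And>r. r \<in> {0..b} \<Longrightarrow> norm (w' r) \<le> C3"
    unfolding bounded_iff by (metis imageI)
  show ?thesis
  proof (rule has_integral_product_rule[OF b])
    fix s t assume st: "0 \<le> s" "s \<le> t" "t \<le> b"
    show "((\<lambda>r. of_real (V r - E) * u r) has_integral u' t - u' s) {s..t}"
      using st by (intro ode_sol_has_integral[OF u]) auto
    show "(w' has_integral w t - w s) {s..t}"
      using st by (intro fundamental_theorem_of_calculus)
        (auto intro: has_vector_derivative_within_subset[OF w])
  next
    fix r assume r: "r \<in> {0..b}"
    have "norm (of_real (V r - E) * u r) = \<bar>V r - E\<bar> * norm (u r)"
      by (simp add: norm_mult flip: of_real_diff)
    also have "\<dots> \<le> C1 * C2"
      using C1[of r] C2[OF r] by (intro mult_mono) auto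
    finally show "norm (of_real (V r - E) * u r) \<le> max (C1 * C2) C3" by simp
    show "norm (w' r) \<le> max (C1 * C2) C3" using C3[OF r] by simp
  next
    show "(\<lambda>r. of_real (V r - E) * u r * w r) integrable_on {0..b}"
      using bounded_potential_integrable[OF V, of 0 b "\<lambda>r. u r * w r" E] uc wc
      by (simp add: mult.assoc continuous_on_mult)
    show "(\<lambda>r. u' r * w' r) integrable_on {0..b}"
      by (intro integrable_continuous_real continuous_on_mult uc w')
  qed
qed

text \<open>Each equation is tested with the other solution; in the difference the terms
  \<open>u' * w'\<close> cancel.\<close>

lemma ode_sol_green:
  fixes u w :: "real \<Rightarrow> complex"
  assumes b: "0 \<le> b" and V: "bounded_potential V" and W: "bounded_potential W"
    and u: "ode_sol V E u u' {0..b}" and w: "ode_sol W D w w' {0..b}"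
  shows "((\<lambda>r. of_real ((V r - E) - (W r - D)) * u r * w r) has_integral
      ((u' b * w b - u b * w' b) - (u' 0 * w 0 - u 0 * w' 0))) {0..b}"
proof -
  note 1 = ode_sol_weak_form[OF b V u ode_sol_has_vector_derivative[OF w] ode_sol_continuous'[OF w]]
  note 2 = ode_sol_weak_form[OF b W w ode_sol_has_vector_derivative[OF u] ode_sol_continuous'[OF u]]
  show ?thesis
    using has_integral_diff[OF 1 2] by (simp add: algebra_simps)
qed

text \<open>Tested with \<open>cnj u\<close>, the weak form has a real integrand, so the imaginary
  part of the boundary term is the same at both ends.\<close>

lemma ode_sol_flux:
  fixes u :: "real \<Rightarrow> complex"
  assumes b: "0 \<le> b" and V: "bounded_potential V" and u: "ode_sol V E u u' {0..b}"
  shows "Im (cnj (u b) * u' b) = Im (cnj (u 0) * u' 0)"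
proof -
  note cu = ode_sol_bounded_linear[OF u bounded_linear_cnj]
  have "((\<lambda>r. Im (of_real (V r - E) * u r * cnj (u r) + u' r * cnj (u' r))) has_integral
      Im (u' b * cnj (u b) - u' 0 * cnj (u 0))) {0..b}"
    using has_integral_linear[OF ode_sol_weak_form[OF b V u ode_sol_has_vector_derivative[OF cu]
        ode_sol_continuous'[OF cu]] bounded_linear_Im]
    by (simp add: o_def)
  moreover have "Im (of_real (V r - E) * u r * cnj (u r) + u' r * cnj (u' r)) = 0" for r
    by (simp add: algebra_simps)
  ultimately have "((\<lambda>r. 0) has_integral Im (u' b * cnj (u b) - u' 0 * cnj (u 0))) {0..b}"
    by simp
  then have "Im (u' b * cnj (u b) - u' 0 * cnj (u 0)) = 0"
    using has_integral_unique[OF _ has_integral_0] by blast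
  then show ?thesis by (simp add: mult.commute)
qed

lemma ode_sol_state:
  fixes u :: "real \<Rightarrow> complex"
  assumes u: "ode_sol V E u u' {0..b}" and t: "t \<in> {0..b}"
  shows "((\<lambda>r. (u' r, of_real (V r - E) * u r)) has_integral (u b, u' b) - (u t, u' t)) {t..b}"
  using has_integral_Pair[OF ode_sol_has_integral'[OF u, of t b] ode_sol_has_integral[OF u, of t b]] t
  by simp

text \<open>The equation becomes a first-order system for the pair of \<open>u\<close> and
  \<open>u'\<close>. A bound \<open>M\<close> on the coefficient makes its right-hand side Lipschitz
  with constant \<open>1 + M\<close>, and measurability in \<open>r\<close> suffices for the Picard
  operator.\<close>

lemma ode_sol_terminal_exists:
  fixes p p' :: complex
  assumes b: "0 \<le> b" and V: "bounded_potential V"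
  obtains u u' where "ode_sol V E u u' {0..b}" "u b = p" "u' b = p'"
proof -
  obtain M where M: "\<And>r. \<bar>V r - E\<bar> \<le> M"
    using bounded_potential_diff[OF V, of E] by (auto simp: bounded_potential_def bounded_iff)
  then have M0: "M \<ge> 0" using order_trans[OF abs_ge_zero M] by blast
  define F :: "real \<Rightarrow> complex \<times> complex \<Rightarrow> complex \<times> complex"
    where "F r x = (snd x, of_real (V r - E) * fst x)" for r x
  have lip: "norm (F r x - F r y) \<le> (1 + M) * norm (x - y)" for r x y
  proof -
    have "norm (F r x - F r y) \<le> norm (snd (x - y)) + norm (of_real (V r - E) * fst (x - y))"
      using norm_Pair_le[of "snd (x - y)" "of_real (V r - E) * fst (x - y)"]
      by (simp add: F_def algebra_simps)
    also have "norm (of_real (V r - E) * fst (x - y)) = \<bar>V r - E\<bar> * norm (fst (x - y))"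
      by (simp only: norm_mult norm_of_real)
    also have "norm (snd (x - y)) + \<dots> \<le> norm (x - y) + M * norm (x - y)"
      using M[of r] M0 norm_fst_le[of "fst (x - y)" "snd (x - y)"] norm_snd_le[of "snd (x - y)" "fst (x - y)"]
      by (intro add_mono mult_mono) (simp_all del: fst_diff snd_diff)
    finally show ?thesis by (simp add: algebra_simps)
  qed
  have int: "(\<lambda>r. F r (x r)) integrable_on {0..b}" if "continuous_on {0..b} x" for x
  proof -
    have "(\<lambda>r. snd (x r)) integrable_on {0..b}"
      by (intro integrable_continuous_real continuous_on_snd that)
    moreover have "(\<lambda>r. of_real (V r - E) * fst (x r)) integrable_on {0..b}"
      by (intro bounded_potential_integrable[OF V] continuous_on_fst that)
    ultimately show ?thesis
      unfolding F_def integrable_on_def by (elim exE) (rule exI, rule has_integral_Pair)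
  qed
  obtain x where xc: "continuous_on {0..b} x"
    and x: "\<And>t. t \<in> {0..b} \<Longrightarrow> x t = (p, p') - integral {t..b} (\<lambda>r. F r (x r))"
    using terminal_value_exists[OF b, of "1 + M" F "(p, p')"] lip int M0 by auto
  define u u' where "u = (\<lambda>t. fst (x t))" and "u' = (\<lambda>t. snd (x t))"
  have *: "((\<lambda>r. F r (x r)) has_integral (x t - x s)) {s..t}" if "0 \<le> s" "s \<le> t" "t \<le> b" for s t
  proof -
    have i: "(\<lambda>r. F r (x r)) integrable_on {s..b}"
      using integrable_subinterval_real[OF int[OF xc], of s b] that by auto
    have "x t - x s = integral {s..b} (\<lambda>r. F r (x r)) - integral {t..b} (\<lambda>r. F r (x r))"
      using x[of s] x[of t] that by simp
    also have "\<dots> = integral {s..t} (\<lambda>r. F r (x r))"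
      using Henstock_Kurzweil_Integration.integral_combine[where a = s and c = t and b = b, OF _ _ i] that
      by (simp add: diff_eq_eq)
    finally have "x t - x s = integral {s..t} (\<lambda>r. F r (x r))" .
    moreover have "(\<lambda>r. F r (x r)) integrable_on {s..t}"
      using integrable_subinterval_real[OF i, of s t] that by auto
    ultimately show ?thesis
      by (auto simp: has_integral_iff)
  qed
  have 1: "(u' has_integral u t - u s) {s..t}" if "0 \<le> s" "s \<le> t" "t \<le> b" for s t
    using has_integral_linear[OF *[OF that] bounded_linear_fst]
    by (simp add: o_def F_def u_def u'_def)
  have 2: "((\<lambda>r. of_real (V r - E) * u r) has_integral u' t - u' s) {s..t}" if "0 \<le> s" "s \<le> t" "t \<le> b" for s t
    using has_integral_linear[OF *[OF that] bounded_linear_snd]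
    by (simp add: o_def F_def u_def u'_def)
  have "ode_sol V E u u' {0..b}"
    unfolding ode_sol_def
  proof (intro conjI ballI impI)
    fix s assume s: "s \<in> {0..b}"
    \<comment> \<open>Continuity of \<open>u'\<close> upgrades the integral relation for
      \<open>u\<close> to a derivative at every point; the equation for \<open>u'\<close> itself
      remains integrated.\<close>
    have "continuous_on {0..b} u'"
      unfolding u'_def by (intro continuous_on_snd xc)
    then have "((\<lambda>t. u 0 + integral {0..t} u') has_vector_derivative u' s) (at s within {0..b})"
      using integral_has_vector_derivative[of 0 b u' s] s by (auto intro!: derivative_eq_intros)
    then show "(u has_vector_derivative u' s) (at s within {0..b})"
      by (rule has_vector_derivative_transform[rotated 2])
         (use s integral_unique[OF 1[of 0]] in auto)
  next
    fix s t assume "s \<in> {0..b}" "t \<in> {0..b}" "s \<le> t"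
    then have "((\<lambda>r. of_real (V r - E) * u r) has_integral u' t - u' s) {s..t}"
      by (intro 2) auto
    then show "(\<lambda>r. of_real (V r - E) * u r) integrable_on {s..t}"
      "u' t - u' s = integral {s..t} (\<lambda>r. of_real (V r - E) * u r)"
      by (auto simp: has_integral_iff)
  qed
  moreover have "u b = p" "u' b = p'"
    using x[of b] b by (auto simp: u_def u'_def)
  ultimately show thesis by (rule that)
qed

text \<open>The difference of the coefficients acts as an inhomogeneity multiplied by the reference
  solution \<open>w\<close>. Hence only \<open>w\<close> needs an a priori bound, and
  \<open>R\<close> is independent of \<open>t\<close>.\<close>

lemma ode_sol_stability:
  fixes u w :: "real \<Rightarrow> complex"
  assumes b: "0 \<le> b" and \<eta>: "0 \<le> \<eta>" and B: "0 \<le> B"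
    and u: "ode_sol V E u u' {0..b}" and w: "ode_sol W D w w' {0..b}"
    and M: "\<And>r. r \<in> {0..b} \<Longrightarrow> \<bar>V r - E\<bar> \<le> M"
    and diff: "\<And>r. r \<in> {0..b} \<Longrightarrow> \<bar>(V r - E) - (W r - D)\<bar> \<le> \<eta>"
    and wB: "\<And>r. r \<in> {0..b} \<Longrightarrow> norm (w r) \<le> B"
    and t: "t \<in> {0..b}"
  defines "R \<equiv> 2 * exp (2 * (1 + M) * b) * (norm (u b - w b) + norm (u' b - w' b) + b * (\<eta> * B))"
  shows "norm (u t - w t) \<le> R" "norm (u' t - w' t) \<le> R"
proof -
  have M0: "M \<ge> 0" using order_trans[OF abs_ge_zero M[of 0]] b by simp
  let ?f = "\<lambda>r. (u' r, of_real (V r - E) * u r)"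
  let ?g = "\<lambda>r. (w' r, of_real (W r - D) * w r)"
  have "norm ((u t, u' t) - (w t, w' t))
      \<le> 2 * exp (2 * (1 + M) * b) * (norm ((u b, u' b) - (w b, w' b)) + b * (\<eta> * B))"
  proof (rule terminal_value_stability[OF b, where f = ?f and g = ?g])
    show "continuous_on {0..b} (\<lambda>t. (u t, u' t))" "continuous_on {0..b} (\<lambda>t. (w t, w' t))"
      using u w by (auto intro!: continuous_on_Pair intro: ode_sol_continuous ode_sol_continuous')
    show "(u t, u' t) = (u b, u' b) - integral {t..b} ?f" if "t \<in> {0..b}" for t
      using integral_unique[OF ode_sol_state[OF u that]] by simp
    show "(w t, w' t) = (w b, w' b) - integral {t..b} ?g" if "t \<in> {0..b}" for t
      using integral_unique[OF ode_sol_state[OF w that]] by simp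
    show "?f integrable_on {0..b}" "?g integrable_on {0..b}"
      using ode_sol_state[OF u, of 0] ode_sol_state[OF w, of 0] b by auto
    fix r assume r: "r \<in> {0..b}"
    let ?x = "norm ((u r, u' r) - (w r, w' r))"
    have "?f r - ?g r = (u' r - w' r,
        of_real (V r - E) * (u r - w r) + of_real ((V r - E) - (W r - D)) * w r)"
      by (simp add: algebra_simps)
    then have "norm (?f r - ?g r) \<le> norm (u' r - w' r)
        + norm (of_real (V r - E) * (u r - w r) + of_real ((V r - E) - (W r - D)) * w r)"
      using norm_Pair_le by metis
    also have "norm (of_real (V r - E) * (u r - w r) + of_real ((V r - E) - (W r - D)) * w r)
        \<le> \<bar>V r - E\<bar> * norm (u r - w r) + \<bar>(V r - E) - (W r - D)\<bar> * norm (w r)"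
      by (rule norm_triangle_le) (simp only: norm_mult norm_of_real)
    also have "\<dots> \<le> M * ?x + \<eta> * B"
      using M[OF r] diff[OF r] wB[OF r] M0 \<eta> norm_fst_le[of "u r - w r" "u' r - w' r"]
      by (intro add_mono mult_mono) auto
    also have "norm (u' r - w' r) \<le> ?x"
      using norm_snd_le[of "u' r - w' r" "u r - w r"] by simp
    finally show "norm (?f r - ?g r) \<le> (1 + M) * ?x + \<eta> * B"
      by (simp add: algebra_simps)
  qed (use M0 \<eta> B t in auto)
  also have "\<dots> \<le> R"
    unfolding R_def using norm_Pair_le[of "u b - w b" "u' b - w' b"] b \<eta> B
    by (intro mult_left_mono add_mono) auto
  finally have "norm (u t - w t, u' t - w' t) \<le> R" by simp
  then show "norm (u t - w t) \<le> R" "norm (u' t - w' t) \<le> R"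
    using norm_fst_le[of "u t - w t" "u' t - w' t"] norm_snd_le[of "u' t - w' t" "u t - w t"] by auto
qed

text \<open>Equal values and derivatives at \<open>b\<close> make the joined function differentiable
  there, and integrals across \<open>b\<close> are split at \<open>b\<close>. This joins a solution
  inside the support to a plane wave outside.\<close>

lemma ode_sol_glue:
  fixes u w :: "real \<Rightarrow> complex"
  assumes b: "0 \<le> b" and u: "ode_sol V E u u' {0..b}" and w: "ode_sol V E w w' {b..}"
    and eq: "u b = w b" "u' b = w' b"
  defines "v \<equiv> \<lambda>s. if s \<in> {0..b} then u s else w s"
    and "v' \<equiv> \<lambda>s. if s \<in> {0..b} then u' s else w' s"
  shows "ode_sol V E v v' {0..}"
proof -
  have D: "(v has_vector_derivative v' s) (at s within {0..})" if "s \<in> {0..}" for s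
    unfolding v_def v'_def
  proof (rule has_vector_derivative_If_within_closures[where T = "{b..}"])
    have c: "closure {0..b} \<inter> closure {b..} = {b}" using b by auto
    show "(u has_vector_derivative u' s) (at s within {0..b} \<union> closure {0..b} \<inter> closure {b..})"
      if "s \<in> {0..b} \<union> closure {0..b} \<inter> closure {b..}"
      using that b ode_sol_has_vector_derivative[OF u, of s] unfolding c by (simp add: insert_absorb)
    show "(w has_vector_derivative w' s) (at s within {b..} \<union> closure {0..b} \<inter> closure {b..})"
      if "s \<in> {b..} \<union> closure {0..b} \<inter> closure {b..}"
      using that b ode_sol_has_vector_derivative[OF w, of s] unfolding c by (simp add: insert_absorb)
    show "u s = w s" "u' s = w' s" if "s \<in> closure {0..b}" "s \<in> closure {b..}"
    proof -
      have "s = b" using that by simp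
      then show "u s = w s" "u' s = w' s" using eq by simp_all
    qed
  qed (use b that in auto)
  have vw: "v s = w s" "v' s = w' s" if "s \<ge> b" for s
  proof -
    have "s = b \<or> s \<notin> {0..b}" using that by auto
    then show "v s = w s" "v' s = w' s" using eq b by (auto simp: v_def v'_def)
  qed
  have I1: "((\<lambda>r. of_real (V r - E) * v r) has_integral (v' t - v' s)) {s..t}"
    if "0 \<le> s" "s \<le> t" "t \<le> b" for s t
  proof -
    have "((\<lambda>r. of_real (V r - E) * u r) has_integral (u' t - u' s)) {s..t}"
      using that by (intro ode_sol_has_integral[OF u]) auto
    then have "((\<lambda>r. of_real (V r - E) * v r) has_integral (u' t - u' s)) {s..t}"
      by (rule has_integral_eq[rotated]) (use that in \<open>auto simp: v_def\<close>)
    then show ?thesis using that by (simp add: v'_def)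
  qed
  have I2: "((\<lambda>r. of_real (V r - E) * v r) has_integral (v' t - v' s)) {s..t}"
    if "b \<le> s" "s \<le> t" for s t
  proof -
    have "((\<lambda>r. of_real (V r - E) * w r) has_integral (w' t - w' s)) {s..t}"
      using that by (intro ode_sol_has_integral[OF w]) auto
    then have "((\<lambda>r. of_real (V r - E) * v r) has_integral (w' t - w' s)) {s..t}"
      by (rule has_integral_eq[rotated]) (use that vw in auto)
    then show ?thesis using that by (simp add: vw)
  qed
  have I: "((\<lambda>r. of_real (V r - E) * v r) has_integral (v' t - v' s)) {s..t}"
    if "0 \<le> s" "s \<le> t" for s t
  proof -
    consider "t \<le> b" | "b \<le> s" | "s \<le> b" "b \<le> t" by linarith
    then show ?thesis
    proof cases
      case 3
      show ?thesis
        using has_integral_combine[OF 3 I1[of s b] I2[of b t]] that 3 by simp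
    qed (use that I1 I2 in auto)
  qed
  show ?thesis
    using D I unfolding ode_sol_def by (auto simp: has_integral_iff)
qed

section \<open>Plane waves, rescaling and superposition\<close>

lemma plane_wave_has_vector_derivative:
  "((\<lambda>s. c * exp (- \<i> * of_real (k * s)) + d * exp (\<i> * of_real (k * s))) has_vector_derivative
    \<i> * of_real k * (d * exp (\<i> * of_real (k * s)) - c * exp (- \<i> * of_real (k * s)))) (at s within S)"
  by (auto intro!: derivative_eq_intros has_vector_derivative_real_field simp: algebra_simps)

lemma ode_sol_plane_wave:
  assumes V: "\<And>r. r > b \<Longrightarrow> V r = 0"
  shows "ode_sol V (k\<^sup>2) (\<lambda>s. c * exp (- \<i> * of_real (k * s)) + d * exp (\<i> * of_real (k * s)))
    (\<lambda>s. \<i> * of_real k * (d * exp (\<i> * of_real (k * s)) - c * exp (- \<i> * of_real (k * s)))) {b..}"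
    (is "ode_sol _ _ ?w ?w' _")
proof -
  have "((\<lambda>r. of_real (V r - k\<^sup>2) * ?w r) has_integral ?w' t - ?w' s) {s..t}"
    if "b \<le> s" "s \<le> t" for s t
  proof -
    have "((\<lambda>r. - of_real (k\<^sup>2) * ?w r) has_integral ?w' t - ?w' s) {s..t}"
    proof (rule fundamental_theorem_of_calculus[OF \<open>s \<le> t\<close>])
      fix r
      show "(?w' has_vector_derivative - of_real (k\<^sup>2) * ?w r) (at r within {s..t})"
        using plane_wave_has_vector_derivative[of "- \<i> * of_real k * c" k "\<i> * of_real k * d" r "{s..t}"]
        by (simp add: algebra_simps power2_eq_square)
    qed
    then show ?thesis
      \<comment> \<open>The potential is known to vanish only beyond \<open>b\<close>; its value at
        the single point \<open>b\<close> does not affect the integral.\<close>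
      by (rule has_integral_spike_finite[of "{b}", rotated 2]) (use V that in auto)
  qed
  then show ?thesis
    using plane_wave_has_vector_derivative unfolding ode_sol_def by (auto simp: has_integral_iff)
qed

lemma ode_sol_rescale:
  fixes u :: "real \<Rightarrow> complex"
  assumes e: "e > 0" and u: "ode_sol (\<lambda>s. c / e\<^sup>2 * Q (s / e)) E u u' {0..}"
  shows "ode_sol (\<lambda>s. c * Q s) (e\<^sup>2 * E) (\<lambda>s. u (e * s)) (\<lambda>s. of_real e * u' (e * s)) {0..}"
proof -
  have D: "((\<lambda>s. u (e * s)) has_vector_derivative of_real e * u' (e * s)) (at s within {0..})"
    if "s \<in> {0..}" for s
  proof -
    have "((\<lambda>s. e * s) has_vector_derivative e) (at s within {0..})"
      by (auto intro!: derivative_eq_intros)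
    moreover have "(u has_vector_derivative u' (e * s)) (at (e * s) within (\<lambda>s. e * s) ` {0..})"
      by (rule has_vector_derivative_within_subset[OF ode_sol_has_vector_derivative[OF u]])
         (use that e in auto)
    ultimately show ?thesis
      using vector_diff_chain_within[of "\<lambda>s. e * s" e s "{0..}" u "u' (e * s)"]
      by (simp add: o_def scaleR_conv_of_real)
  qed
  have I: "((\<lambda>r. of_real (c * Q r - e\<^sup>2 * E) * u (e * r)) has_integral
      (of_real e * u' (e * t) - of_real e * u' (e * s))) {s..t}"
    if "0 \<le> s" "s \<le> t" for s t
  proof -
    have "((\<lambda>r. of_real (c / e\<^sup>2 * Q (r / e) - E) * u r) has_integral (u' (e * t) - u' (e * s))) {e * s..e * t}"
      using that e by (intro ode_sol_has_integral[OF u]) auto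
    \<comment> \<open>The substitution contributes \<open>1 / e\<close> and clearing the denominator
      of the potential contributes \<open>e\<^sup>2\<close>; their product is the factor
      \<open>e\<close> of the rescaled derivative.\<close>
    from has_integral_mult_right[OF has_integral_stretch_real[OF this, of e], of "of_real (e\<^sup>2)"]
    have "((\<lambda>r. of_real (e\<^sup>2) * (of_real (c / e\<^sup>2 * Q r - E) * u (e * r))) has_integral
        of_real (e\<^sup>2) * ((1 / e) *\<^sub>R (u' (e * t) - u' (e * s)))) {s..t}"
      using e by simp
    moreover have "of_real (e\<^sup>2) * (of_real (c / e\<^sup>2 * Q r - E) * u (e * r)) = of_real (c * Q r - e\<^sup>2 * E) * u (e * r)" for r
      using e by (simp add: field_simps)
    ultimately show ?thesis
      using e by (simp add: scaleR_conv_of_real power2_eq_square algebra_simps)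
  qed
  show ?thesis
    using D I unfolding ode_sol_def by (auto simp: has_integral_iff)
qed

lemma ode_sol_add:
  assumes u: "ode_sol V E u u' S" and w: "ode_sol V E w w' S"
  shows "ode_sol V E (\<lambda>s. u s + w s) (\<lambda>s. u' s + w' s) S"
proof -
  have "((\<lambda>r. of_real (V r - E) * (u r + w r)) has_integral (u' t + w' t - (u' s + w' s))) {s..t}"
    if "s \<in> S" "t \<in> S" "s \<le> t" for s t
    using has_integral_add[OF ode_sol_has_integral[OF u that] ode_sol_has_integral[OF w that]]
    by (simp add: algebra_simps)
  then show ?thesis
    using ode_sol_has_vector_derivative[OF u] ode_sol_has_vector_derivative[OF w]
    unfolding ode_sol_def by (auto simp: has_integral_iff intro: has_vector_derivative_add)
qed

lemma ode_sol_cmult: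
  fixes u :: "real \<Rightarrow> complex"
  shows "ode_sol V E u u' S \<Longrightarrow> ode_sol V E (\<lambda>s. c * u s) (\<lambda>s. c * u' s) S"
  by (rule ode_sol_bounded_linear) (simp_all add: bounded_linear_mult_right)

text \<open>The form of \<open>u\<close> is known only to the right of \<open>b\<close>, but a
  one-sided derivative is unique, so \<open>u' b\<close> is that of the wave.\<close>

lemma ode_sol_plane_wave_derivative:
  fixes u :: "real \<Rightarrow> complex"
  assumes u: "ode_sol V E u u' {0..}" and b: "0 \<le> b"
    and eq: "\<And>s. s \<ge> b \<Longrightarrow> u s = c * exp (- \<i> * of_real (k * s)) + d * exp (\<i> * of_real (k * s))"
  shows "u' b = \<i> * of_real k * (d * exp (\<i> * of_real (k * b)) - c * exp (- \<i> * of_real (k * b)))"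
proof (rule vector_derivative_unique_within_closed_interval[of b "b + 1" b])
  show "(u has_vector_derivative u' b) (at b within cbox b (b + 1))"
    by (rule has_vector_derivative_within_subset[OF ode_sol_has_vector_derivative[OF u]]) (use b in auto)
  show "(u has_vector_derivative
      \<i> * of_real k * (d * exp (\<i> * of_real (k * b)) - c * exp (- \<i> * of_real (k * b)))) (at b within cbox b (b + 1))"
    by (rule has_vector_derivative_transform[OF _ _ plane_wave_has_vector_derivative]) (use eq in auto)
qed auto

lemma ode_sol_plane_wave_exists:
  fixes c d :: complex
  assumes b: "0 \<le> b" and V: "bounded_potential V" "\<And>r. r > b \<Longrightarrow> V r = 0"
  obtains u u' where "ode_sol V (k\<^sup>2) u u' {0..}"
    "\<And>s. s \<ge> b \<Longrightarrow> u s = c * exp (- \<i> * of_real (k * s)) + d * exp (\<i> * of_real (k * s))"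
proof -
  define w where "w s = c * exp (- \<i> * of_real (k * s)) + d * exp (\<i> * of_real (k * s))" for s
  define w' where "w' s = \<i> * of_real k * (d * exp (\<i> * of_real (k * s)) - c * exp (- \<i> * of_real (k * s)))" for s
  have w: "ode_sol V (k\<^sup>2) w w' {b..}"
    unfolding w_def w'_def by (rule ode_sol_plane_wave[OF V(2)])
  obtain u u' where u: "ode_sol V (k\<^sup>2) u u' {0..b}" "u b = w b" "u' b = w' b"
    using ode_sol_terminal_exists[OF b V(1)] by blast
  show thesis
  proof (rule that[OF ode_sol_glue[OF b u(1) w u(2,3)]])
    show "(if s \<in> {0..b} then u s else w s)
        = c * exp (- \<i> * of_real (k * s)) + d * exp (\<i> * of_real (k * s))" if "s \<ge> b" for s
    proof -
      have "(if s \<in> {0..b} then u s else w s) = w s"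
        using that u(2) by (cases "s = b") auto
      then show ?thesis by (simp add: w_def)
    qed
  qed
qed

section \<open>Scattering on the star graph\<close>

text \<open>With \<open>x\<close> and \<open>y\<close> the incoming and outgoing parts at a point,
  the interference terms are purely imaginary before the factor \<open>\<i>\<close> and therefore
  drop out of the imaginary part.\<close>

lemma Im_flux_two_waves:
  "Im (cnj (x + y) * (\<i> * of_real k * (y - x))) = k * ((cmod y)\<^sup>2 - (cmod x)\<^sup>2)"
  unfolding cmod_power2 by (simp add: algebra_simps power2_eq_square)

lemma plane_wave_flux:
  fixes u :: "real \<Rightarrow> complex"
  assumes b: "0 \<le> b" and V: "bounded_potential V" and u: "ode_sol V E u u' {0..}"
    and eq: "\<And>s. s \<ge> b \<Longrightarrow> u s = c * exp (- \<i> * of_real (k * s)) + d * exp (\<i> * of_real (k * s))"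
  shows "Im (cnj (u 0) * u' 0) = k * ((cmod d)\<^sup>2 - (cmod c)\<^sup>2)"
proof -
  have "Im (cnj (u 0) * u' 0) = Im (cnj (u b) * u' b)"
    using ode_sol_flux[OF b V ode_sol_subset[OF u]] by auto
  also have "\<dots> = k * ((cmod (d * exp (\<i> * of_real (k * b))))\<^sup>2 - (cmod (c * exp (- \<i> * of_real (k * b))))\<^sup>2)"
    using ode_sol_plane_wave_derivative[OF u b eq] eq[of b] by (simp only: Im_flux_two_waves order_refl)
  also have "\<dots> = k * ((cmod d)\<^sup>2 - (cmod c)\<^sup>2)"
    by (simp add: norm_mult)
  finally show ?thesis .
qed

text \<open>The common vertex value factors out of the total flux, and the sum of the derivatives
  vanishes. General incoming amplitudes \<open>c\<close> serve two purposes: a unit wave on one edge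
  gives unitarity, \<open>c = 0\<close> gives uniqueness.\<close>

lemma star_flux_balance:
  fixes u :: "nat \<Rightarrow> real \<Rightarrow> complex"
  assumes k: "k \<noteq> 0" and b: "\<And>j. j < n \<Longrightarrow> 0 \<le> b j" and V: "\<And>j. j < n \<Longrightarrow> bounded_potential (V j)"
    and u: "\<And>j. j < n \<Longrightarrow> ode_sol (V j) E (u j) (u' j) {0..}"
    and cont: "\<And>j j'. j < n \<Longrightarrow> j' < n \<Longrightarrow> u j 0 = u j' 0" and bal: "(\<Sum>j<n. u' j 0) = 0"
    and eq: "\<And>j s. j < n \<Longrightarrow> s \<ge> b j \<Longrightarrow>
      u j s = c j * exp (- \<i> * of_real (k * s)) + d j * exp (\<i> * of_real (k * s))"
  shows "(\<Sum>j<n. (cmod (d j))\<^sup>2) = (\<Sum>j<n. (cmod (c j))\<^sup>2)"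
proof -
  have "k * ((\<Sum>j<n. (cmod (d j))\<^sup>2) - (\<Sum>j<n. (cmod (c j))\<^sup>2)) = (\<Sum>j<n. k * ((cmod (d j))\<^sup>2 - (cmod (c j))\<^sup>2))"
    by (simp add: sum_subtractf sum_distrib_left algebra_simps)
  also have "\<dots> = (\<Sum>j<n. Im (cnj (u 0 0) * u' j 0))"
  proof (rule sum.cong)
    fix j assume "j \<in> {..<n}"
    then have j: "j < n" by simp
    have "k * ((cmod (d j))\<^sup>2 - (cmod (c j))\<^sup>2) = Im (cnj (u j 0) * u' j 0)"
      using plane_wave_flux[OF b[OF j] V[OF j] u[OF j] eq[OF j]] by simp
    also have "u j 0 = u 0 0" using cont[of j 0] j by simp
    finally show "k * ((cmod (d j))\<^sup>2 - (cmod (c j))\<^sup>2) = Im (cnj (u 0 0) * u' j 0)" .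
  qed simp
  also have "\<dots> = Im (cnj (u 0 0) * (\<Sum>j<n. u' j 0))"
    by (simp only: sum_distrib_left Im_sum)
  finally show ?thesis using k bal by simp
qed

text \<open>The Kronecker delta becomes a coefficient of the incoming exponential, which is the
  shape \<open>c * exp + d * exp\<close> of the plane wave lemmas. The elimination rule that follows
  does the same in the other direction.\<close>

lemma Teps_propI:
  assumes "\<And>j. j \<ge> n \<Longrightarrow> t j = 0"
    and "\<And>j. j < n \<Longrightarrow> ode_sol (\<lambda>s. lamf e / e\<^sup>2 * Q j (s / e)) (k\<^sup>2) (u j) (u' j) {0..}"
    and "\<And>j j'. j < n \<Longrightarrow> j' < n \<Longrightarrow> u j 0 = u j' 0" "(\<Sum>j<n. u' j 0) = 0"
    and "\<And>j s. j < n \<Longrightarrow> s \<ge> e * a j \<Longrightarrow> u j s =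
      (if i = j then 1 else 0) * exp (- \<i> * of_real (k * s)) + t j * exp (\<i> * of_real (k * s))"
  shows "Teps_prop n a Q lamf e k i t"
  unfolding Teps_prop_def
proof (rule conjI)
  show "\<forall>j\<ge>n. t j = 0" using assms(1) by blast
  have "\<forall>j<n. \<forall>s\<ge>e * a j. u j s =
      (if i = j then exp (- \<i> * of_real (k * s)) else 0) + t j * exp (\<i> * of_real (k * s))"
    using assms(5) by simp
  then show "\<exists>u u'. (\<forall>j<n. ode_sol (\<lambda>s. lamf e / e\<^sup>2 * Q j (s / e)) (k\<^sup>2) (u j) (u' j) {0..}) \<and>
      (\<forall>j<n. \<forall>j'<n. u j 0 = u j' 0) \<and> (\<Sum>j<n. u' j 0) = 0 \<and>
      (\<forall>j<n. \<forall>s\<ge>e * a j. u j s =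
        (if i = j then exp (- \<i> * of_real (k * s)) else 0) + t j * exp (\<i> * of_real (k * s)))"
    using assms(2-4) by blast
qed

lemma Teps_propE:
  assumes "Teps_prop n a Q lamf e k i t"
  obtains u u' where
    "\<forall>j<n. ode_sol (\<lambda>s. lamf e / e\<^sup>2 * Q j (s / e)) (k\<^sup>2) (u j) (u' j) {0..}"
    "\<forall>j<n. \<forall>j'<n. u j 0 = u j' 0" "(\<Sum>j<n. u' j 0) = 0"
    "\<forall>j<n. \<forall>s\<ge>e * a j. u j s =
      (if i = j then 1 else 0) * exp (- \<i> * of_real (k * s)) + t j * exp (\<i> * of_real (k * s))"
proof -
  have if_eq: "(if i = j then x else 0) = (if i = j then 1 else 0) * x" for j and x :: complex
    by simp
  show thesis
    using assms unfolding Teps_prop_def if_eq[of _ "exp _"] by (elim exE conjE) (rule that)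
qed

section \<open>Existence, uniqueness and unitarity of the amplitudes at fixed size\<close>

locale star_graph =
  fixes n :: nat and a :: "nat \<Rightarrow> real" and Q :: "nat \<Rightarrow> real \<Rightarrow> real"
  assumes a_pos: "j < n \<Longrightarrow> a j > 0"
    and Q_pot: "j < n \<Longrightarrow> bounded_potential (Q j)"
    and Q_supp: "j < n \<Longrightarrow> s > a j \<Longrightarrow> Q j s = 0"
begin

lemma scaled_potential:
  assumes "e > 0" "j < n"
  shows "bounded_potential (\<lambda>s. c / e\<^sup>2 * Q j (s / e))" "s > e * a j \<Longrightarrow> c / e\<^sup>2 * Q j (s / e) = 0"
    "0 \<le> e * a j"
proof -
  show "bounded_potential (\<lambda>s. c / e\<^sup>2 * Q j (s / e))"
    by (rule bounded_potential_rescale[OF Q_pot[OF assms(2)]])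
  show "c / e\<^sup>2 * Q j (s / e) = 0" if "s > e * a j"
    using Q_supp[OF assms(2), of "s / e"] that assms(1) by (simp add: field_simps)
qed (use assms a_pos[of j] in simp)

lemma Teps_unitary:
  assumes t: "Teps_prop n a Q lamf e k i t" and e: "e > 0" and k: "k \<noteq> 0" and i: "i < n"
  shows "(\<Sum>j<n. (cmod (t j))\<^sup>2) = 1"
proof -
  let ?V = "\<lambda>j s. lamf e / e\<^sup>2 * Q j (s / e)"
  obtain u u' where "\<forall>j<n. ode_sol (\<lambda>s. lamf e / e\<^sup>2 * Q j (s / e)) (k\<^sup>2) (u j) (u' j) {0..}"
    and "\<forall>j<n. \<forall>j'<n. u j 0 = u j' 0" and bal: "(\<Sum>j<n. u' j 0) = 0"
    and "\<forall>j<n. \<forall>s\<ge>e * a j. u j s =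
      (if i = j then 1 else 0) * exp (- \<i> * of_real (k * s)) + t j * exp (\<i> * of_real (k * s))"
    by (rule Teps_propE[OF t])
  note u = this(1)[rule_format] and kir = this(2)[rule_format] bal and eq = this(4)[rule_format]
  have "(\<Sum>j<n. (cmod (t j))\<^sup>2) = (\<Sum>j<n. (cmod (if i = j then 1 else 0))\<^sup>2)"
    using scaled_potential(3)[OF e] scaled_potential(1)[OF e] u kir eq
    by (rule star_flux_balance[OF k])
  also have "\<dots> = (\<Sum>j<n. if i = j then 1 else 0)"
    by (intro sum.cong) auto
  finally show ?thesis using i by simp
qed

text \<open>The difference of two scattering solutions has no incoming wave, so the flux balance
  forces its outgoing amplitudes to vanish.\<close>

lemma Teps_unique:
  assumes t: "Teps_prop n a Q lamf e k i t" "Teps_prop n a Q lamf e k i t'" and e: "e > 0" and k: "k \<noteq> 0"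
  shows "t = t'"
proof
  fix j
  let ?V = "\<lambda>j s. lamf e / e\<^sup>2 * Q j (s / e)"
  obtain u u' where "\<forall>j<n. ode_sol (?V j) (k\<^sup>2) (u j) (u' j) {0..}"
    and "\<forall>j<n. \<forall>j'<n. u j 0 = u j' 0" and bal: "(\<Sum>j<n. u' j 0) = 0"
    and "\<forall>j<n. \<forall>s\<ge>e * a j. u j s =
      (if i = j then 1 else 0) * exp (- \<i> * of_real (k * s)) + t j * exp (\<i> * of_real (k * s))"
    by (rule Teps_propE[OF t(1)])
  note u = this(1)[rule_format] and kir = this(2)[rule_format] bal and eq = this(4)[rule_format]
  obtain w w' where "\<forall>j<n. ode_sol (?V j) (k\<^sup>2) (w j) (w' j) {0..}"
    and "\<forall>j<n. \<forall>j'<n. w j 0 = w j' 0" and wbal: "(\<Sum>j<n. w' j 0) = 0"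
    and "\<forall>j<n. \<forall>s\<ge>e * a j. w j s =
      (if i = j then 1 else 0) * exp (- \<i> * of_real (k * s)) + t' j * exp (\<i> * of_real (k * s))"
    by (rule Teps_propE[OF t(2)])
  note w = this(1)[rule_format] and wkir = this(2)[rule_format] wbal and weq = this(4)[rule_format]
  have "(\<Sum>j<n. (cmod (t j - t' j))\<^sup>2) = (\<Sum>j<n. (cmod 0)\<^sup>2)"
  proof (rule star_flux_balance[OF k, of n "\<lambda>j. e * a j" ?V "k\<^sup>2" "\<lambda>j s. u j s + (- 1) * w j s" "\<lambda>j s. u' j s + (- 1) * w' j s"])
    show "ode_sol (?V j) (k\<^sup>2) (\<lambda>s. u j s + (- 1) * w j s) (\<lambda>s. u' j s + (- 1) * w' j s) {0..}" if "j < n" for j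
      by (intro ode_sol_add ode_sol_cmult u w that)
    show "u j 0 + (- 1) * w j 0 = u j' 0 + (- 1) * w j' 0" if "j < n" "j' < n" for j j'
      using kir(1)[OF that] wkir(1)[OF that] by simp
    show "(\<Sum>j<n. u' j 0 + (- 1) * w' j 0) = 0"
      using kir(2) wkir(2) by (simp add: sum_subtractf)
    show "u j s + (- 1) * w j s = 0 * exp (- \<i> * of_real (k * s)) + (t j - t' j) * exp (\<i> * of_real (k * s))"
      if "j < n" "s \<ge> e * a j" for j s
      using eq[OF that] weq[OF that] by (simp add: algebra_simps)
  qed (fact scaled_potential(3)[OF e] scaled_potential(1)[OF e])+
  then have "t j = t' j" if "j < n"
    using that by (simp add: sum_nonneg_eq_0_iff)
  moreover have "t j = t' j" if "j \<ge> n"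
    using t that by (simp add: Teps_prop_def)
  ultimately show "t j = t' j" by (meson linorder_not_less)
qed

text \<open>The solutions \<open>f j\<close> that are outgoing at infinity carry flux \<open>k\<close>. Hence \<open>f j 0 \<noteq> 0\<close> and all
  logarithmic derivatives \<open>\<rho> j\<close> lie in the upper half plane, so their sum does not vanish and the
  Kirchhoff conditions can be solved for the common value \<open>C\<close> at the vertex.\<close>

lemma Teps_exists:
  assumes e: "e > 0" and k: "k > 0" and i: "i < n"
  shows "\<exists>t. Teps_prop n a Q lamf e k i t"
proof -
  let ?V = "\<lambda>j s. lamf e / e\<^sup>2 * Q j (s / e)"
  \<comment> \<open>Any pair of incoming and outgoing amplitudes can be prescribed beyond the
    support. Below, \<open>f\<close> takes only the outgoing wave and \<open>g\<close> only the
    given incoming one, so \<open>g j + t j * f j\<close> has the required form for every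
    \<open>t\<close>.\<close>
  have jost: "\<exists>u u'. ode_sol (?V j) (k\<^sup>2) u u' {0..} \<and>
      (\<forall>s\<ge>e * a j. u s = c * exp (- \<i> * of_real (k * s)) + d * exp (\<i> * of_real (k * s)))"
    if "j < n" for j c d
    using ode_sol_plane_wave_exists[of "e * a j" "?V j" k c d] scaled_potential[OF e that] by metis
  have "\<forall>j. \<exists>f f'. j < n \<longrightarrow> ode_sol (?V j) (k\<^sup>2) f f' {0..} \<and>
      (\<forall>s\<ge>e * a j. f s = 0 * exp (- \<i> * of_real (k * s)) + 1 * exp (\<i> * of_real (k * s)))"
    using jost by blast
  then obtain f f' where f: "\<And>j. j < n \<Longrightarrow> ode_sol (?V j) (k\<^sup>2) (f j) (f' j) {0..}"
    and f_eq: "\<And>j s. j < n \<Longrightarrow> s \<ge> e * a j \<Longrightarrow>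
      f j s = 0 * exp (- \<i> * of_real (k * s)) + 1 * exp (\<i> * of_real (k * s))"
    by metis
  have "\<forall>j. \<exists>g g'. j < n \<longrightarrow> ode_sol (?V j) (k\<^sup>2) g g' {0..} \<and>
      (\<forall>s\<ge>e * a j. g s = (if i = j then 1 else 0) * exp (- \<i> * of_real (k * s)) + 0 * exp (\<i> * of_real (k * s)))"
    using jost by blast
  then obtain g g' where g: "\<And>j. j < n \<Longrightarrow> ode_sol (?V j) (k\<^sup>2) (g j) (g' j) {0..}"
    and g_eq: "\<And>j s. j < n \<Longrightarrow> s \<ge> e * a j \<Longrightarrow>
      g j s = (if i = j then 1 else 0) * exp (- \<i> * of_real (k * s)) + 0 * exp (\<i> * of_real (k * s))"
    by metis
  define \<rho> where "\<rho> j = f' j 0 / f j 0" for j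
  have flux: "Im (cnj (f j 0) * f' j 0) = k" if "j < n" for j
    using plane_wave_flux[OF scaled_potential(3)[OF e that] scaled_potential(1)[OF e that] f[OF that] f_eq[OF that]]
    by simp
  have f0: "f j 0 \<noteq> 0" if "j < n" for j
    using flux[OF that] k by auto
  have \<rho>_pos: "Im (\<rho> j) > 0" if "j < n" for j
  proof -
    have "\<rho> j = (cnj (f j 0) * f' j 0) / of_real ((cmod (f j 0))\<^sup>2)"
      using f0[OF that] unfolding \<rho>_def
      by (simp add: complex_norm_square field_simps del: of_real_power)
    then have "Im (\<rho> j) = k / (cmod (f j 0))\<^sup>2"
      using flux[OF that] by (simp only: Im_divide_of_real)
    then show ?thesis using k f0[OF that] by simp
  qed
  have "Im (\<Sum>j<n. \<rho> j) > 0"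
    unfolding Im_sum by (rule sum_pos) (use \<rho>_pos i in auto)
  then have \<rho>_nz: "(\<Sum>j<n. \<rho> j) \<noteq> 0" by (metis less_irrefl zero_complex.sel(2))
  \<comment> \<open>Continuity with vertex value \<open>C\<close> forces
    \<open>t j = (C - g j 0) / f j 0\<close>; inserting this into the balance of derivatives gives a
    linear equation for \<open>C\<close> with this solution.\<close>
  define C where "C = (\<Sum>j<n. g j 0 * \<rho> j - g' j 0) / (\<Sum>j<n. \<rho> j)"
  define t where "t j = (if j < n then (C - g j 0) / f j 0 else 0)" for j
  have "Teps_prop n a Q lamf e k i t"
  proof (rule Teps_propI[where u = "\<lambda>j s. g j s + t j * f j s" and u' = "\<lambda>j s. g' j s + t j * f' j s"])
    show "ode_sol (?V j) (k\<^sup>2) (\<lambda>s. g j s + t j * f j s) (\<lambda>s. g' j s + t j * f' j s) {0..}" if "j < n" for j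
      by (intro ode_sol_add ode_sol_cmult f g that)
    have "g j 0 + t j * f j 0 = C" if "j < n" for j
      using that f0[OF that] by (simp add: t_def)
    then show "g j 0 + t j * f j 0 = g j' 0 + t j' * f j' 0" if "j < n" "j' < n" for j j'
      using that by simp
    have "(\<Sum>j<n. g' j 0 + t j * f' j 0) = (\<Sum>j<n. C * \<rho> j - (g j 0 * \<rho> j - g' j 0))"
      by (intro sum.cong) (auto simp: t_def \<rho>_def f0 field_simps)
    also have "\<dots> = C * (\<Sum>j<n. \<rho> j) - (\<Sum>j<n. g j 0 * \<rho> j - g' j 0)"
      by (simp only: sum_subtractf sum_distrib_left)
    also have "\<dots> = 0"
      using \<rho>_nz by (simp add: C_def)
    finally show "(\<Sum>j<n. g' j 0 + t j * f' j 0) = 0" .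
    show "g j s + t j * f j s =
        (if i = j then 1 else 0) * exp (- \<i> * of_real (k * s)) + t j * exp (\<i> * of_real (k * s))"
      if "j < n" "s \<ge> e * a j" for j s
      using f_eq[OF that] g_eq[OF that] by auto
  qed (auto simp: t_def)
  then show ?thesis by (intro exI[of _ t])
qed

text \<open>In the variable \<open>s / e\<close> the edges have fixed length and the energy is of
  order \<open>e\<^sup>2\<close>. The factor \<open>e\<close> in the outer derivatives is kept
  explicit because Green's identity is later divided by it.\<close>

lemma Teps_rescaled:
  assumes t: "Teps_prop n a Q lamf e k i t" and e: "e > 0"
  obtains v v' where "\<forall>j<n. ode_sol (\<lambda>s. lamf e * Q j s) (e\<^sup>2 * k\<^sup>2) (v j) (v' j) {0..a j}"
    "\<forall>j<n. \<forall>j'<n. v j 0 = v j' 0" "(\<Sum>j<n. v' j 0) = 0"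
    "\<forall>j<n. v j (a j) = (if i = j then 1 else 0) * exp (- \<i> * of_real (k * (e * a j)))
        + t j * exp (\<i> * of_real (k * (e * a j)))"
    "\<forall>j<n. v' j (a j) = of_real e * (\<i> * of_real k * (t j * exp (\<i> * of_real (k * (e * a j)))
        - (if i = j then 1 else 0) * exp (- \<i> * of_real (k * (e * a j)))))"
proof -
  obtain u u' where "\<forall>j<n. ode_sol (\<lambda>s. lamf e / e\<^sup>2 * Q j (s / e)) (k\<^sup>2) (u j) (u' j) {0..}"
    and "\<forall>j<n. \<forall>j'<n. u j 0 = u j' 0" and bal: "(\<Sum>j<n. u' j 0) = 0"
    and "\<forall>j<n. \<forall>s\<ge>e * a j. u j s =
      (if i = j then 1 else 0) * exp (- \<i> * of_real (k * s)) + t j * exp (\<i> * of_real (k * s))"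
    by (rule Teps_propE[OF t])
  note u = this(1)[rule_format] and kir = this(2)[rule_format] bal and eq = this(4)[rule_format]
  show thesis
  proof (rule that[of "\<lambda>j s. u j (e * s)" "\<lambda>j s. of_real e * u' j (e * s)"]; (intro allI impI)?)
    fix j assume j: "j < n"
    show "ode_sol (\<lambda>s. lamf e * Q j s) (e\<^sup>2 * k\<^sup>2) (\<lambda>s. u j (e * s)) (\<lambda>s. of_real e * u' j (e * s)) {0..a j}"
      by (rule ode_sol_subset[OF ode_sol_rescale[OF e u[OF j]]]) auto
    show "of_real e * u' j (e * a j) = of_real e * (\<i> * of_real k * (t j * exp (\<i> * of_real (k * (e * a j)))
        - (if i = j then 1 else 0) * exp (- \<i> * of_real (k * (e * a j)))))"
      using ode_sol_plane_wave_derivative[OF u[OF j] scaled_potential(3)[OF e j] eq[OF j]] by simp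
    show "u j (e * a j) = (if i = j then 1 else 0) * exp (- \<i> * of_real (k * (e * a j)))
        + t j * exp (\<i> * of_real (k * (e * a j)))"
      by (rule eq[OF j order_refl])
    show "u j (e * 0) = u j' (e * 0)" if "j' < n" for j'
      using kir(1)[OF j that] by simp
  next
    show "(\<Sum>j<n. of_real e * u' j (e * 0)) = 0"
      using bal by (simp flip: sum_distrib_left)
  qed
qed

end

section \<open>The limit of vanishing size\<close>

text \<open>Passes to the limit in the volume terms of Green's identity, with \<open>V\<close> equal
  to \<open>Q\<close> or to 1.\<close>

lemma integral_tendsto_of_uniform_bound:
  fixes v :: "nat \<Rightarrow> real \<Rightarrow> complex"
  assumes b: "0 \<le> b" and V: "bounded_potential V" and p: "continuous_on {0..b} p"
    and v: "\<And>r. continuous_on {0..b} (v r)" and w: "continuous_on {0..b} w"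
    and R: "R \<longlonglongrightarrow> 0" "\<And>r x. x \<in> {0..b} \<Longrightarrow> norm (v r x - w x) \<le> R r"
  shows "(\<lambda>r. integral {0..b} (\<lambda>x. of_real (V x) * v r x * p x))
    \<longlonglongrightarrow> integral {0..b} (\<lambda>x. of_real (V x) * w x * p x)"
proof -
  obtain C1 where C1: "\<And>r. \<bar>V r\<bar> \<le> C1"
    using V by (auto simp: bounded_potential_def bounded_iff)
  have "bounded (p ` {0..b})"
    by (intro compact_imp_bounded compact_continuous_image p) simp
  then obtain C2 where C2: "\<And>x. x \<in> {0..b} \<Longrightarrow> norm (p x) \<le> C2"
    unfolding bounded_iff by blast
  have int: "(\<lambda>x. of_real (V x) * u x * p x) integrable_on {0..b}" if "continuous_on {0..b} u" for u
    using bounded_potential_integrable[OF V, of 0 b "\<lambda>x. u x * p x" 0] that p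
    by (simp add: mult.assoc continuous_on_mult)
  have le: "norm (integral {0..b} (\<lambda>x. of_real (V x) * v r x * p x) - integral {0..b} (\<lambda>x. of_real (V x) * w x * p x))
      \<le> (C1 * C2) * R r * b" for r
  proof -
    have C: "C1 \<ge> 0" "C2 \<ge> 0" "R r \<ge> 0"
      using order_trans[OF abs_ge_zero C1] order_trans[OF norm_ge_zero C2[of 0]] order_trans[OF norm_ge_zero R(2)[of 0 r]] b
      by auto
    have "((\<lambda>x. of_real (V x) * v r x * p x - of_real (V x) * w x * p x) has_integral
        integral {0..b} (\<lambda>x. of_real (V x) * v r x * p x) - integral {0..b} (\<lambda>x. of_real (V x) * w x * p x)) (cbox 0 b)"
      using has_integral_diff[OF integrable_integral[OF int[OF v[of r]]] integrable_integral[OF int[OF w]]] by simp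
    then have "norm (integral {0..b} (\<lambda>x. of_real (V x) * v r x * p x) - integral {0..b} (\<lambda>x. of_real (V x) * w x * p x))
        \<le> ((C1 * C2) * R r) * measure lborel (cbox 0 b)"
    proof (rule has_integral_bound[rotated])
      fix x assume "x \<in> cbox 0 b"
      then have x: "x \<in> {0..b}" by simp
      have "of_real (V x) * v r x * p x - of_real (V x) * w x * p x = of_real (V x) * p x * (v r x - w x)"
        by (simp add: algebra_simps)
      then have "norm (of_real (V x) * v r x * p x - of_real (V x) * w x * p x) = \<bar>V x\<bar> * norm (p x) * norm (v r x - w x)"
        by (simp only: norm_mult norm_of_real)
      also have "\<dots> \<le> C1 * C2 * R r"
        using C C1[of x] C2[OF x] R(2)[OF x, of r] by (intro mult_mono) auto
      finally show "norm (of_real (V x) * v r x * p x - of_real (V x) * w x * p x) \<le> C1 * C2 * R r" .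
    qed (use C in auto)
    then show ?thesis using b by (simp add: content_real)
  qed
  have "(\<lambda>r. (C1 * C2) * R r * b) \<longlonglongrightarrow> (C1 * C2) * 0 * b"
    by (intro tendsto_intros R(1))
  then have lim: "(\<lambda>r. (C1 * C2) * R r * b) \<longlonglongrightarrow> 0" by simp
  show ?thesis
    by (rule LIM_zero_cancel, rule Lim_null_comparison[OF _ lim]) (intro always_eventually allI le)
qed

text \<open>Convergence of the outer data and of the coefficients yields one null sequence
  \<open>R\<close> controlling \<open>v\<close> and \<open>v'\<close> on the whole edge, in
  particular at the vertex.\<close>

lemma ode_sol_limit:
  fixes v :: "nat \<Rightarrow> real \<Rightarrow> complex"
  assumes b: "0 \<le> b" and Q: "bounded_potential Q" and \<mu>: "\<mu> \<longlonglongrightarrow> (1::real)" and E: "E \<longlonglongrightarrow> (0::real)"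
    and v: "\<And>r. ode_sol (\<lambda>s. \<mu> r * Q s) (E r) (v r) (v' r) {0..b}"
    and vb: "(\<lambda>r. v r b) \<longlonglongrightarrow> w b" "(\<lambda>r. v' r b) \<longlonglongrightarrow> w' b"
    and w: "ode_sol Q 0 w w' {0..b}"
  obtains R where "R \<longlonglongrightarrow> 0" "\<And>r x. x \<in> {0..b} \<Longrightarrow> norm (v r x - w x) \<le> R r"
    "\<And>r x. x \<in> {0..b} \<Longrightarrow> norm (v' r x - w' x) \<le> R r"
proof -
  obtain C where C: "\<And>s. \<bar>Q s\<bar> \<le> C"
    using Q by (auto simp: bounded_potential_def bounded_iff)
  have C0: "C \<ge> 0" using order_trans[OF abs_ge_zero C] by blast
  \<comment> \<open>Bounds on the convergent parameters make the exponential constant in the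
    stability estimate independent of \<open>r\<close>.\<close>
  obtain M1 where M1: "\<And>r. \<bar>\<mu> r\<bar> \<le> M1"
    using convergent_imp_Bseq[OF convergentI[OF \<mu>]] by (auto simp: Bseq_def)
  obtain M2 where M2: "\<And>r. \<bar>E r\<bar> \<le> M2"
    using convergent_imp_Bseq[OF convergentI[OF E]] by (auto simp: Bseq_def)
  have "bounded (w ` {0..b})"
    by (intro compact_imp_bounded compact_continuous_image ode_sol_continuous[OF w]) simp
  then obtain B where B: "\<And>x. x \<in> {0..b} \<Longrightarrow> norm (w x) \<le> B"
    unfolding bounded_iff by blast
  have B0: "B \<ge> 0" using order_trans[OF norm_ge_zero B[of 0]] b by simp
  define \<eta> where "\<eta> r = \<bar>\<mu> r - 1\<bar> * C + \<bar>E r\<bar>" for r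
  define R where "R r = 2 * exp (2 * (1 + (M1 * C + M2)) * b)
    * (norm (v r b - w b) + norm (v' r b - w' b) + b * (\<eta> r * B))" for r
  have est: "norm (v r x - w x) \<le> R r \<and> norm (v' r x - w' x) \<le> R r" if x: "x \<in> {0..b}" for r x
  proof -
    have M: "\<bar>\<mu> r * Q s - E r\<bar> \<le> M1 * C + M2" for s
    proof -
      have "\<bar>\<mu> r * Q s - E r\<bar> \<le> \<bar>\<mu> r\<bar> * \<bar>Q s\<bar> + \<bar>E r\<bar>"
        by (metis abs_mult abs_triangle_ineq4)
      also have "\<dots> \<le> M1 * C + M2"
        using M1[of r] M2[of r] C[of s] by (intro add_mono mult_mono) auto
      finally show ?thesis .
    qed
    have d: "\<bar>(\<mu> r * Q s - E r) - (Q s - 0)\<bar> \<le> \<eta> r" for s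
    proof -
      have "(\<mu> r * Q s - E r) - (Q s - 0) = (\<mu> r - 1) * Q s - E r"
        by (simp add: algebra_simps)
      then have "\<bar>(\<mu> r * Q s - E r) - (Q s - 0)\<bar> \<le> \<bar>\<mu> r - 1\<bar> * \<bar>Q s\<bar> + \<bar>E r\<bar>"
        by (metis abs_mult abs_triangle_ineq4)
      also have "\<dots> \<le> \<eta> r"
        unfolding \<eta>_def using C[of s] by (intro add_mono mult_left_mono) auto
      finally show ?thesis .
    qed
    have "\<eta> r \<ge> 0" using C0 by (simp add: \<eta>_def)
    from ode_sol_stability[OF b this B0 v[of r] w M d B x] show ?thesis
      unfolding R_def by blast
  qed
  have "(\<lambda>r. v r b - w b) \<longlonglongrightarrow> 0" "(\<lambda>r. v' r b - w' b) \<longlonglongrightarrow> 0"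
    using vb by (auto intro: LIM_zero)
  then have "R \<longlonglongrightarrow> 2 * exp (2 * (1 + (M1 * C + M2)) * b)
      * (norm (0::complex) + norm (0::complex) + b * ((\<bar>1 - 1\<bar> * C + \<bar>0\<bar>) * B))"
    unfolding R_def \<eta>_def by (intro tendsto_intros \<mu> E)
  then show thesis
    using est by (intro that[of R]) auto
qed

section \<open>Uniqueness for the limit matching problem\<close>

lemma Tlim_prop_iff:
  assumes "c = (\<lambda>j. if i = j then 1 else 0)"
  shows "Tlim_prop n m th q lam k i t \<longleftrightarrow> (\<forall>j\<ge>n. t j = 0) \<and>
    (\<forall>j\<in>{m..<n}. c j + t j = (\<Sum>i'<m. of_real (th i' j) * (c i' + t i'))) \<and>
    (\<forall>i'<m. \<i> * of_real k * (t i' - c i')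
        + (\<Sum>j\<in>{m..<n}. of_real (th i' j) * (\<i> * of_real k * (t j - c j)))
      = of_real lam * (\<Sum>j<m. of_real (q i' j) * (c j + t j)))"
  unfolding Tlim_prop_def Let_def assms right_minus_eq ..

text \<open>The difference \<open>d\<close> of two solutions satisfies the homogeneous conditions.
  Pairing the second one with \<open>cnj (d i')\<close> and using the first gives
  \<open>\<i> * k\<close> times the squared norm of \<open>d\<close> on one side and the real number
  \<open>lam * S\<close> on the other, so \<open>d = 0\<close>.\<close>

lemma Tlim_unique:
  assumes q: "\<And>i j. q i j = q j i" and m: "m \<le> n" and k: "k \<noteq> 0"
    and t: "Tlim_prop n m th q lam k i t" and t': "Tlim_prop n m th q lam k i t'"
  shows "t = t'"
proof
  fix x
  define d where "d j = t j - t' j" for j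
  define c :: "nat \<Rightarrow> complex" where "c = (\<lambda>j. if i = j then 1 else 0)"
  note T = t[unfolded Tlim_prop_iff[OF c_def]] and T' = t'[unfolded Tlim_prop_iff[OF c_def]]
  have A: "d j = (\<Sum>i'<m. of_real (th i' j) * d i')" if "j \<in> {m..<n}" for j
  proof -
    have "d j = (c j + t j) - (c j + t' j)"
      by (simp add: d_def)
    also have "\<dots> = (\<Sum>i'<m. of_real (th i' j) * (c i' + t i')) - (\<Sum>i'<m. of_real (th i' j) * (c i' + t' i'))"
      using T T' that by simp
    also have "\<dots> = (\<Sum>i'<m. of_real (th i' j) * d i')"
      unfolding sum_subtractf[symmetric] by (intro sum.cong refl) (simp add: d_def algebra_simps)
    finally show ?thesis .
  qed
  have B: "\<i> * of_real k * (d i' + (\<Sum>j\<in>{m..<n}. of_real (th i' j) * d j)) = of_real lam * (\<Sum>j<m. of_real (q i' j) * d j)"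
    if "i' < m" for i'
  proof -
    have eq: "\<i> * of_real k * (s i' - c i') + (\<Sum>j\<in>{m..<n}. of_real (th i' j) * (\<i> * of_real k * (s j - c j)))
        = of_real lam * (\<Sum>j<m. of_real (q i' j) * (c j + s j))" if "s = t \<or> s = t'" for s
      using T T' that \<open>i' < m\<close> by blast
    from eq[of t] eq[of t'] have "\<i> * of_real k * (t i' - c i') - \<i> * of_real k * (t' i' - c i')
        + ((\<Sum>j\<in>{m..<n}. of_real (th i' j) * (\<i> * of_real k * (t j - c j)))
            - (\<Sum>j\<in>{m..<n}. of_real (th i' j) * (\<i> * of_real k * (t' j - c j))))
        = of_real lam * ((\<Sum>j<m. of_real (q i' j) * (c j + t j)) - (\<Sum>j<m. of_real (q i' j) * (c j + t' j)))"
      by (simp add: algebra_simps)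
    moreover have "\<i> * of_real k * (t i' - c i') - \<i> * of_real k * (t' i' - c i') = \<i> * of_real k * d i'"
      by (simp add: d_def algebra_simps)
    moreover have "(\<Sum>j\<in>{m..<n}. of_real (th i' j) * (\<i> * of_real k * (t j - c j)))
            - (\<Sum>j\<in>{m..<n}. of_real (th i' j) * (\<i> * of_real k * (t' j - c j)))
        = \<i> * of_real k * (\<Sum>j\<in>{m..<n}. of_real (th i' j) * d j)"
      unfolding sum_subtractf[symmetric] sum_distrib_left
      by (intro sum.cong) (simp_all add: d_def algebra_simps)
    moreover have "(\<Sum>j<m. of_real (q i' j) * (c j + t j)) - (\<Sum>j<m. of_real (q i' j) * (c j + t' j))
        = (\<Sum>j<m. of_real (q i' j) * d j)"
      unfolding sum_subtractf[symmetric] by (intro sum.cong) (simp_all add: d_def algebra_simps)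
    ultimately show ?thesis
      by (simp only: distrib_left)
  qed
  \<comment> \<open>\<open>S\<close> is the Hermitian form of the real symmetric matrix
    \<open>q\<close> at \<open>d\<close>, hence real.\<close>
  define S where "S = (\<Sum>i'<m. \<Sum>j<m. of_real (q i' j) * d j * cnj (d i'))"
  have "cnj S = (\<Sum>i'<m. \<Sum>j<m. of_real (q i' j) * d i' * cnj (d j))"
    by (simp add: S_def mult_ac)
  also have "\<dots> = (\<Sum>j<m. \<Sum>i'<m. of_real (q i' j) * d i' * cnj (d j))"
    by (rule sum.swap)
  also have "\<dots> = S"
    unfolding S_def by (intro sum.cong refl) (subst q, rule refl)
  finally have "cnj S = S" .
  then have "Im S = 0"
    by (simp add: complex_eq_iff)
  \<comment> \<open>The same \<open>th\<close> occurs in both conditions, transposed; after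
    exchanging the sums the first condition collapses the inner sum to \<open>cnj (d j)\<close> and
    supplies the squares for the edges from \<open>m\<close> on.\<close>
  have "(\<Sum>i'<m. cnj (d i') * (\<Sum>j\<in>{m..<n}. of_real (th i' j) * d j))
      = (\<Sum>j\<in>{m..<n}. \<Sum>i'<m. cnj (d i') * (of_real (th i' j) * d j))"
    unfolding sum_distrib_left by (rule sum.swap)
  also have "\<dots> = (\<Sum>j\<in>{m..<n}. d j * cnj (d j))"
  proof (intro sum.cong refl)
    fix j assume j: "j \<in> {m..<n}"
    have "cnj (d j) = (\<Sum>i'<m. of_real (th i' j) * cnj (d i'))"
      by (subst A[OF j]) simp
    then show "(\<Sum>i'<m. cnj (d i') * (of_real (th i' j) * d j)) = d j * cnj (d j)"
      by (simp add: sum_distrib_left mult_ac)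
  qed
  finally have cross: "(\<Sum>i'<m. cnj (d i') * (\<Sum>j\<in>{m..<n}. of_real (th i' j) * d j)) = (\<Sum>j\<in>{m..<n}. d j * cnj (d j))" .
  have "of_real lam * S = (\<Sum>i'<m. cnj (d i') * (of_real lam * (\<Sum>j<m. of_real (q i' j) * d j)))"
    by (simp add: S_def sum_distrib_left mult_ac)
  also have "\<dots> = (\<Sum>i'<m. cnj (d i') * (\<i> * of_real k * (d i' + (\<Sum>j\<in>{m..<n}. of_real (th i' j) * d j))))"
    using B by (intro sum.cong refl) simp
  also have "\<dots> = \<i> * of_real k * ((\<Sum>i'<m. d i' * cnj (d i'))
      + (\<Sum>i'<m. cnj (d i') * (\<Sum>j\<in>{m..<n}. of_real (th i' j) * d j)))"
    unfolding sum.distrib[symmetric] sum_distrib_left[of "\<i> * of_real k"]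
    by (intro sum.cong refl) (simp only: distrib_left mult_ac)
  also have "\<dots> = \<i> * of_real k * (\<Sum>j<n. d j * cnj (d j))"
  proof -
    have "(\<Sum>j<m. d j * cnj (d j)) + (\<Sum>j\<in>{m..<n}. d j * cnj (d j)) = (\<Sum>j<n. d j * cnj (d j))"
      unfolding lessThan_atLeast0 by (rule sum.atLeastLessThan_concat[OF le0 m])
    then show ?thesis
      unfolding cross by (simp only:)
  qed
  also have "\<dots> = \<i> * of_real k * of_real (\<Sum>j<n. (cmod (d j))\<^sup>2)"
    by (simp only: of_real_sum complex_norm_square)
  finally have eq: "of_real lam * S = \<i> * of_real k * of_real (\<Sum>j<n. (cmod (d j))\<^sup>2)" .
  have Im_eq: "Im (\<i> * of_real k * of_real X) = k * X" for X
    by simp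
  have "Im (of_real lam * S) = 0"
    by (simp add: \<open>Im S = 0\<close>)
  then have "k * (\<Sum>j<n. (cmod (d j))\<^sup>2) = 0"
    unfolding eq Im_eq .
  then have "(\<Sum>j<n. (cmod (d j))\<^sup>2) = 0" using k by simp
  then have "\<forall>j\<in>{..<n}. (cmod (d j))\<^sup>2 = 0"
    by (subst (asm) sum_nonneg_eq_0_iff) simp_all
  then have "d j = 0" if "j < n" for j
    using that by simp
  moreover have "d j = 0" if "j \<ge> n" for j
    using T T' that by (simp add: d_def)
  ultimately have "d x = 0" by (meson linorder_not_less)
  then show "t x = t' x" by (simp add: d_def)
qed

section \<open>Limit points of the amplitudes and the solutions of (R)\<close>

lemma finite_family_convergent_subsequence:
  fixes f :: "nat \<Rightarrow> nat \<Rightarrow> 'a::heine_borel"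
  assumes "\<And>j. j < n \<Longrightarrow> bounded (range (\<lambda>r. f r j))"
  shows "\<exists>s l. strict_mono s \<and> (\<forall>j<n. (\<lambda>r. f (s r) j) \<longlonglongrightarrow> l j)"
  using assms
proof (induction n)
  case 0
  then show ?case using strict_mono_id by auto
next
  case (Suc n)
  then obtain s l where s: "strict_mono s" and l: "\<And>j. j < n \<Longrightarrow> (\<lambda>r. f (s r) j) \<longlonglongrightarrow> l j"
    by (metis less_SucI)
  have "bounded (range (\<lambda>r. f (s r) n))"
    by (rule bounded_subset[OF Suc.prems[of n]]) auto
  then obtain y s' where s': "strict_mono s'" "((\<lambda>r. f (s r) n) \<circ> s') \<longlonglongrightarrow> y"
    using bounded_imp_convergent_subsequence by blast
  have "(\<lambda>r. f ((s \<circ> s') r) j) \<longlonglongrightarrow> (l(n := y)) j" if "j < Suc n" for j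
  proof (cases "j = n")
    case False
    then show ?thesis
      using LIMSEQ_subseq_LIMSEQ[OF l[of j] s'(1)] that by (simp add: o_def)
  qed (use s'(2) in \<open>simp add: o_def\<close>)
  then show ?case
    using strict_mono_o[OF s s'(1)] by blast
qed

text \<open>Spanning is stated outright, and linear independence is contained in the normalisation
  at the first \<open>m\<close> endpoints; together they say that \<open>psi\<close> is a basis of
  solutions of (R).\<close>

locale star_resonance = star_graph +
  fixes m :: nat and psi :: "nat \<Rightarrow> nat \<Rightarrow> real \<Rightarrow> real"
  assumes m_le: "m \<le> n"
    and psi_sol: "i < m \<Longrightarrow> solR n a Q (psi i)"
    and psi_span: "solR n a Q phi \<Longrightarrow>
      \<exists>c. \<forall>l<n. \<forall>s\<in>{0..a l}. phi l s = (\<Sum>i<m. c i * psi i l s)"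
    and psi_norm: "i < m \<Longrightarrow> j < m \<Longrightarrow> psi i j (a j) = (if i = j then 1 else 0)"
begin

lemma solR_expansion:
  assumes phi: "solR n a Q phi" and l: "l < n" and s: "s \<in> {0..a l}"
  shows "phi l s = (\<Sum>i<m. phi i (a i) * psi i l s)"
proof -
  obtain c where c: "\<And>l s. l < n \<Longrightarrow> s \<in> {0..a l} \<Longrightarrow> phi l s = (\<Sum>i<m. c i * psi i l s)"
    using psi_span[OF phi] by blast
  have "phi j (a j) = c j" if j: "j < m" for j
  proof -
    have "phi j (a j) = (\<Sum>i<m. c i * psi i j (a j))"
      using c[of j "a j"] j m_le a_pos[of j] by simp
    also have "\<dots> = (\<Sum>i<m. if i = j then c i else 0)"
      using psi_norm j by (intro sum.cong) auto
    also have "\<dots> = c j" using j by simp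
    finally show ?thesis .
  qed
  then show ?thesis
    using c[OF l s] by simp
qed

text \<open>(R) is formulated for real functions, so the expansion is applied to the real and
  imaginary parts, which solve (R) separately.\<close>

lemma complex_solR_expansion:
  fixes w :: "nat \<Rightarrow> real \<Rightarrow> complex"
  assumes w: "\<And>l. l < n \<Longrightarrow> ode_sol (Q l) 0 (w l) (w' l) {0..a l}"
    and cont: "\<And>l l'. l < n \<Longrightarrow> l' < n \<Longrightarrow> w l 0 = w l' 0"
    and bal: "(\<Sum>l<n. w' l 0) = 0" and neu: "\<And>l. l < n \<Longrightarrow> w' l (a l) = 0"
    and l: "l < n" and s: "s \<in> {0..a l}"
  shows "w l s = (\<Sum>i<m. w i (a i) * of_real (psi i l s))"
proof -
  have sol: "solR n a Q (\<lambda>l s. h (w l s))" if h: "bounded_linear h" for h :: "complex \<Rightarrow> real"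
    unfolding solR_def
  proof (intro exI[of _ "\<lambda>l s. h (w' l s)"] conjI allI impI)
    interpret h: bounded_linear h by (rule h)
    show "ode_sol (Q l) 0 (\<lambda>s. h (w l s)) (\<lambda>s. h (w' l s)) {0..a l}" if "l < n" for l
      by (rule ode_sol_bounded_linear[OF w[OF that] h])
    show "h (w l 0) = h (w l' 0)" if "l < n" "l' < n" for l l'
      using cont[OF that] by simp
    show "(\<Sum>l<n. h (w' l 0)) = 0"
      using bal by (simp add: h.zero flip: h.sum)
    show "h (w' l (a l)) = 0" if "l < n" for l
      using neu[OF that] by (simp add: h.zero)
  qed
  show ?thesis
    using solR_expansion[OF sol[OF bounded_linear_Re] l s] solR_expansion[OF sol[OF bounded_linear_Im] l s]
    by (simp add: complex_eq_iff)
qed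

text \<open>Identifies the limiting volume term of Green's identity as row \<open>i\<close> of
  \<open>q\<close> applied to the coordinates of \<open>w\<close>.\<close>

lemma qmat_pairing:
  fixes w :: "nat \<Rightarrow> real \<Rightarrow> complex"
  assumes l: "\<And>l. l < n \<Longrightarrow> continuous_on {0..a l} (w l)"
    and w: "\<And>l s. l < n \<Longrightarrow> s \<in> {0..a l} \<Longrightarrow> w l s = (\<Sum>j<m. c j * of_real (psi j l s))" and i: "i < m"
  shows "(\<Sum>l<n. integral {0..a l} (\<lambda>s. of_real (Q l s) * w l s * of_real (psi i l s)))
    = (\<Sum>j<m. of_real (qmat n a Q psi i j) * c j)"
proof -
  have psi_cont: "continuous_on {0..a l} (psi j l)" if "j < m" "l < n" for j l
    using psi_sol[OF that(1)] that(2) unfolding solR_def by (blast intro: ode_sol_continuous)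
  have int: "((\<lambda>s. complex_of_real (Q l s * psi i l s * psi j l s)) has_integral
      of_real (integral {0..a l} (\<lambda>s. Q l s * psi i l s * psi j l s))) {0..a l}"
    if "j < m" "l < n" for j l
  proof -
    have "(\<lambda>s. complex_of_real (Q l s - 0) * of_real (psi i l s * psi j l s)) integrable_on {0..a l}"
      by (intro bounded_potential_integrable Q_pot continuous_intros psi_cont i that)
    then have "(\<lambda>s. Re (complex_of_real (Q l s - 0) * of_real (psi i l s * psi j l s))) integrable_on {0..a l}"
      by (rule integrable_linear[OF _ bounded_linear_Re, unfolded o_def])
    then have "(\<lambda>s. Q l s * psi i l s * psi j l s) integrable_on {0..a l}"
      by (simp add: mult.assoc)
    from has_integral_linear[OF integrable_integral[OF this] bounded_linear_of_real[where 'a = complex]]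
    show ?thesis by (simp add: o_def)
  qed
  have "integral {0..a l} (\<lambda>s. of_real (Q l s) * w l s * of_real (psi i l s))
      = (\<Sum>j<m. of_real (integral {0..a l} (\<lambda>s. Q l s * psi i l s * psi j l s)) * c j)" if "l < n" for l
  proof (rule integral_unique, rule has_integral_eq)
    show "((\<lambda>s. \<Sum>j<m. complex_of_real (Q l s * psi i l s * psi j l s) * c j) has_integral
        (\<Sum>j<m. of_real (integral {0..a l} (\<lambda>s. Q l s * psi i l s * psi j l s)) * c j)) {0..a l}"
      by (intro has_integral_sum has_integral_mult_left int that) auto
    show "(\<Sum>j<m. complex_of_real (Q l s * psi i l s * psi j l s) * c j)
        = of_real (Q l s) * w l s * of_real (psi i l s)" if "s \<in> {0..a l}" for s
      unfolding w[OF \<open>l < n\<close> that] by (simp add: sum_distrib_left sum_distrib_right mult_ac)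
  qed
  then have "(\<Sum>l<n. integral {0..a l} (\<lambda>s. of_real (Q l s) * w l s * of_real (psi i l s)))
      = (\<Sum>l<n. \<Sum>j<m. of_real (integral {0..a l} (\<lambda>s. Q l s * psi i l s * psi j l s)) * c j)"
    by simp
  also have "\<dots> = (\<Sum>j<m. \<Sum>l<n. of_real (integral {0..a l} (\<lambda>s. Q l s * psi i l s * psi j l s)) * c j)"
    by (rule sum.swap)
  also have "\<dots> = (\<Sum>j<m. of_real (qmat n a Q psi i j) * c j)"
    by (simp add: qmat_def sum_distrib_right)
  finally show ?thesis .
qed

lemma Tlim_of_limit_point:
  assumes e_pos: "\<And>r. e r > 0" and e: "e \<longlonglongrightarrow> 0"
    and lam1: "(\<lambda>r. lamf (e r)) \<longlonglongrightarrow> 1" and lam2: "(\<lambda>r. (lamf (e r) - 1) / e r) \<longlonglongrightarrow> lam"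
    and t: "\<And>r. Teps_prop n a Q lamf (e r) k i (t r)"
    and T: "\<And>j. j < n \<Longrightarrow> (\<lambda>r. t r j) \<longlonglongrightarrow> T j" "\<And>j. j \<ge> n \<Longrightarrow> T j = 0"
  shows "Tlim_prop n m (theta a psi) (qmat n a Q psi) lam k i T"
proof -
  define c :: "nat \<Rightarrow> complex" where "c = (\<lambda>j. if i = j then 1 else 0)"
  define P where "P r v v' \<longleftrightarrow>
    (\<forall>j<n. ode_sol (\<lambda>s. lamf (e r) * Q j s) ((e r)\<^sup>2 * k\<^sup>2) (v j) (v' j) {0..a j}) \<and>
    (\<forall>j<n. \<forall>j'<n. v j 0 = v j' 0) \<and> (\<Sum>j<n. v' j 0) = 0 \<and>
    (\<forall>j<n. v j (a j) = c j * exp (- \<i> * of_real (k * (e r * a j))) + t r j * exp (\<i> * of_real (k * (e r * a j)))) \<and>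
    (\<forall>j<n. v' j (a j) = of_real (e r) * (\<i> * of_real k * (t r j * exp (\<i> * of_real (k * (e r * a j)))
        - c j * exp (- \<i> * of_real (k * (e r * a j))))))" for r and v v' :: "nat \<Rightarrow> real \<Rightarrow> complex"
  have "\<exists>v v'. P r v v'" for r
    unfolding P_def c_def by (rule Teps_rescaled[OF t[of r] e_pos[of r]]) (intro exI conjI)
  then obtain v v' where P: "\<And>r. P r (v r) (v' r)" by metis
  have v: "ode_sol (\<lambda>s. lamf (e r) * Q j s) ((e r)\<^sup>2 * k\<^sup>2) (v r j) (v' r j) {0..a j}" if "j < n" for r j
    using P[of r] that unfolding P_def by blast
  have v_cont: "v r j 0 = v r j' 0" if "j < n" "j' < n" for r j j'
    using P[of r] that unfolding P_def by blast
  have v_bal: "(\<Sum>j<n. v' r j 0) = 0" for r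
    using P[of r] unfolding P_def by blast
  have v_end: "v r j (a j) = c j * exp (- \<i> * of_real (k * (e r * a j))) + t r j * exp (\<i> * of_real (k * (e r * a j)))"
    if "j < n" for r j
    using P[of r] that unfolding P_def by blast
  have v'_end: "v' r j (a j) = of_real (e r) * (\<i> * of_real k * (t r j * exp (\<i> * of_real (k * (e r * a j)))
        - c j * exp (- \<i> * of_real (k * (e r * a j)))))" if "j < n" for r j
    using P[of r] that unfolding P_def by blast
  have v_lim: "(\<lambda>r. v r j (a j)) \<longlonglongrightarrow> c j + T j" if j: "j < n" for j
  proof -
    have "(\<lambda>r. c j * exp (- \<i> * of_real (k * (e r * a j))) + t r j * exp (\<i> * of_real (k * (e r * a j))))
        \<longlonglongrightarrow> c j * exp (- \<i> * of_real (k * (0 * a j))) + T j * exp (\<i> * of_real (k * (0 * a j)))"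
      by (intro tendsto_intros e T j)
    then show ?thesis by (simp add: v_end[OF j])
  qed
  \<comment> \<open>The limit one order beyond the Neumann condition: at leading order the outer
    derivative vanishes, and the next coefficient enters the second matching condition.\<close>
  have v'_lim1: "(\<lambda>r. v' r j (a j) / of_real (e r)) \<longlonglongrightarrow> \<i> * of_real k * (T j - c j)" if j: "j < n" for j
  proof -
    have "(\<lambda>r. \<i> * of_real k * (t r j * exp (\<i> * of_real (k * (e r * a j))) - c j * exp (- \<i> * of_real (k * (e r * a j)))))
        \<longlonglongrightarrow> \<i> * of_real k * (T j * exp (\<i> * of_real (k * (0 * a j))) - c j * exp (- \<i> * of_real (k * (0 * a j))))"
      by (intro tendsto_intros e T j)
    moreover have "v' r j (a j) / of_real (e r)
        = \<i> * of_real k * (t r j * exp (\<i> * of_real (k * (e r * a j))) - c j * exp (- \<i> * of_real (k * (e r * a j))))" for r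
      using e_pos[of r] unfolding v'_end[OF j] by (intro nonzero_mult_div_cancel_left) simp
    ultimately show ?thesis by simp
  qed
  have v'_lim: "(\<lambda>r. v' r j (a j)) \<longlonglongrightarrow> 0" if j: "j < n" for j
  proof -
    have "(\<lambda>r. of_real (e r) * (v' r j (a j) / of_real (e r))) \<longlonglongrightarrow> of_real 0 * (\<i> * of_real k * (T j - c j))"
      by (intro tendsto_intros e v'_lim1 j)
    moreover have "of_real (e r) * (v' r j (a j) / of_real (e r)) = v' r j (a j)" for r
      using e_pos[of r] by simp
    ultimately show ?thesis by simp
  qed
  \<comment> \<open>The candidate limit is built edge by edge from the limiting outer data. Nothing
    is imposed at the vertex; the Kirchhoff conditions are inherited below from the convergence
    \<open>lim0\<close>.\<close>
  have "\<exists>w w'. ode_sol (Q l) 0 w w' {0..a l} \<and> w (a l) = c l + T l \<and> w' (a l) = 0" if "l < n" for l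
    using ode_sol_terminal_exists[of "a l" "Q l" 0 "c l + T l" 0] Q_pot[OF that] a_pos[OF that]
    by (metis less_imp_le)
  then obtain w w' where w: "\<And>l. l < n \<Longrightarrow> ode_sol (Q l) 0 (w l) (w' l) {0..a l}"
    and w_end: "\<And>l. l < n \<Longrightarrow> w l (a l) = c l + T l" and w'_end: "\<And>l. l < n \<Longrightarrow> w' l (a l) = 0"
    by metis
  have e2: "(\<lambda>r. (e r)\<^sup>2 * k\<^sup>2) \<longlonglongrightarrow> 0"
    using tendsto_mult[OF tendsto_power[OF e, of 2] tendsto_const[of "k\<^sup>2"]] by simp
  have "\<exists>R. R \<longlonglongrightarrow> 0 \<and> (\<forall>r. \<forall>x\<in>{0..a l}. norm (v r l x - w l x) \<le> R r \<and> norm (v' r l x - w' l x) \<le> R r)"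
    if l: "l < n" for l
  proof -
    have ends: "(\<lambda>r. v r l (a l)) \<longlonglongrightarrow> w l (a l)" "(\<lambda>r. v' r l (a l)) \<longlonglongrightarrow> w' l (a l)"
      using v_lim[OF l] v'_lim[OF l] w_end[OF l] w'_end[OF l] by simp_all
    show ?thesis
      by (rule ode_sol_limit[OF less_imp_le[OF a_pos[OF l]] Q_pot[OF l] lam1 e2 v[OF l] ends w[OF l]]) blast
  qed
  then obtain R where R: "\<And>l. l < n \<Longrightarrow> R l \<longlonglongrightarrow> 0"
    and Rv: "\<And>l r x. l < n \<Longrightarrow> x \<in> {0..a l} \<Longrightarrow> norm (v r l x - w l x) \<le> R l r"
    and Rv': "\<And>l r x. l < n \<Longrightarrow> x \<in> {0..a l} \<Longrightarrow> norm (v' r l x - w' l x) \<le> R l r"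
    by metis
  have lim0: "(\<lambda>r. v r l 0) \<longlonglongrightarrow> w l 0" "(\<lambda>r. v' r l 0) \<longlonglongrightarrow> w' l 0" if l: "l < n" for l
    using Rv[OF l, of 0] Rv'[OF l, of 0] a_pos[OF l]
    by (auto intro!: LIM_zero_cancel Lim_null_comparison[OF always_eventually R[OF l]])
  have w_cont: "w l 0 = w l' 0" if "l < n" "l' < n" for l l'
    using LIMSEQ_unique[OF lim0(1)[OF that(1)]] lim0(1)[OF that(2)] v_cont[OF that] by simp
  have "(\<lambda>r. \<Sum>j<n. v' r j 0) \<longlonglongrightarrow> (\<Sum>j<n. w' j 0)"
    by (intro tendsto_sum lim0) simp
  then have w_bal: "(\<Sum>j<n. w' j 0) = 0"
    unfolding v_bal by (simp add: LIMSEQ_const_iff)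
  have w_exp: "w l s = (\<Sum>j<m. (c j + T j) * of_real (psi j l s))" if "l < n" "s \<in> {0..a l}" for l s
    using complex_solR_expansion[OF w w_cont w_bal w'_end that] w_end m_le by simp
  \<comment> \<open>The expansion of \<open>w\<close> is evaluated at the outer endpoint of edge
    \<open>j\<close>.\<close>
  have first: "c j + T j = (\<Sum>i'<m. of_real (theta a psi i' j) * (c i' + T i'))" if "j < n" for j
    using w_exp[OF that, of "a j"] w_end[OF that] a_pos[OF that] by (simp add: theta_def mult.commute)
  have second: "\<i> * of_real k * (T i' - c i')
        + (\<Sum>j\<in>{m..<n}. of_real (theta a psi i' j) * (\<i> * of_real k * (T j - c j)))
      = of_real lam * (\<Sum>j<m. of_real (qmat n a Q psi i' j) * (c j + T j))" if i': "i' < m" for i'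
  proof -
    obtain psi' where psi: "\<And>l. l < n \<Longrightarrow> ode_sol (Q l) 0 (psi i' l) (psi' l) {0..a l}"
      and psi_cont: "\<And>l l'. l < n \<Longrightarrow> l' < n \<Longrightarrow> psi i' l 0 = psi i' l' 0"
      and psi_bal: "(\<Sum>l<n. psi' l 0) = 0" and psi_neu: "\<And>l. l < n \<Longrightarrow> psi' l (a l) = 0"
      using psi_sol[OF i'] unfolding solR_def by blast
    define p where "p l s = complex_of_real (psi i' l s)" for l s
    define p' where "p' l s = complex_of_real (psi' l s)" for l s
    have p: "ode_sol (Q l) 0 (p l) (p' l) {0..a l}" if "l < n" for l
      using ode_sol_bounded_linear[OF psi[OF that] bounded_linear_of_real[where 'a = complex]]
      by (simp add: p_def[abs_def] p'_def[abs_def])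
    have pc: "continuous_on {0..a l} (p l)" if "l < n" for l
      by (rule ode_sol_continuous[OF p[OF that]])
    define I1 where "I1 r l = integral {0..a l} (\<lambda>s. of_real (Q l s) * v r l s * p l s)" for r l
    define I2 where "I2 r l = integral {0..a l} (\<lambda>s. of_real 1 * v r l s * p l s)" for r l
    have one: "bounded_potential (\<lambda>_. 1)"
      by (simp add: bounded_potential_def)
    note lim = integral_tendsto_of_uniform_bound[OF less_imp_le[OF a_pos] _ pc
        ode_sol_continuous[OF v] ode_sol_continuous[OF w] R Rv]
    have I1_lim: "(\<lambda>r. I1 r l) \<longlonglongrightarrow> integral {0..a l} (\<lambda>s. of_real (Q l s) * w l s * p l s)"
      if l: "l < n" for l
      unfolding I1_def by (rule lim[OF l Q_pot[OF l] l l l l l])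
    have I2_lim: "(\<lambda>r. I2 r l) \<longlonglongrightarrow> integral {0..a l} (\<lambda>s. of_real 1 * w l s * p l s)"
      if l: "l < n" for l
      unfolding I2_def by (rule lim[OF l one l l l l l])
    have green: "v' r l (a l) * p l (a l) - (v' r l 0 * p l 0 - v r l 0 * p' l 0)
        = of_real (lamf (e r) - 1) * I1 r l - of_real ((e r)\<^sup>2 * k\<^sup>2) * I2 r l" if l: "l < n" for r l
    proof -
      have vp: "continuous_on {0..a l} (\<lambda>s. v r l s * p l s)"
        by (intro continuous_intros pc ode_sol_continuous[OF v] l)
      have i1: "((\<lambda>s. of_real (Q l s) * v r l s * p l s) has_integral I1 r l) {0..a l}"
        using bounded_potential_integrable[OF Q_pot[OF l] vp, of 0]
        by (simp add: I1_def mult.assoc integrable_integral)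
      have i2: "((\<lambda>s. of_real 1 * v r l s * p l s) has_integral I2 r l) {0..a l}"
        using integrable_continuous_real[OF vp] by (simp add: I2_def integrable_integral)
      have "((\<lambda>s. of_real (lamf (e r) - 1) * (of_real (Q l s) * v r l s * p l s)
          - of_real ((e r)\<^sup>2 * k\<^sup>2) * (of_real 1 * v r l s * p l s)) has_integral
          of_real (lamf (e r) - 1) * I1 r l - of_real ((e r)\<^sup>2 * k\<^sup>2) * I2 r l) {0..a l}"
        by (intro has_integral_diff has_integral_mult_right i1 i2)
      moreover have "of_real (lamf (e r) - 1) * (of_real (Q l s) * v r l s * p l s)
          - of_real ((e r)\<^sup>2 * k\<^sup>2) * (of_real 1 * v r l s * p l s)
          = of_real ((lamf (e r) * Q l s - (e r)\<^sup>2 * k\<^sup>2) - (Q l s - 0)) * v r l s * p l s" for s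
        by (simp add: algebra_simps)
      ultimately have "((\<lambda>s. of_real ((lamf (e r) * Q l s - (e r)\<^sup>2 * k\<^sup>2) - (Q l s - 0)) * v r l s * p l s) has_integral
          of_real (lamf (e r) - 1) * I1 r l - of_real ((e r)\<^sup>2 * k\<^sup>2) * I2 r l) {0..a l}"
        by (simp only:)
      from has_integral_unique[OF ode_sol_green[OF less_imp_le[OF a_pos[OF l]]
            bounded_potential_cmult[OF Q_pot[OF l]] Q_pot[OF l] v[OF l] p[OF l]] this]
      show ?thesis
        using psi_neu[OF l] by (simp add: p'_def)
    qed
    \<comment> \<open>Both functions have a common value at the vertex, so these values factor out
      of the two derivative sums, each of which vanishes.\<close>
    have bdry: "(\<Sum>l<n. v' r l 0 * p l 0 - v r l 0 * p' l 0) = 0" for r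
    proof -
      have "(\<Sum>l<n. v' r l 0 * p l 0 - v r l 0 * p' l 0) = (\<Sum>l<n. v' r l 0 * p 0 0 - v r 0 0 * p' l 0)"
      proof (intro sum.cong refl)
        fix l assume "l \<in> {..<n}"
        then have "l < n" "0 < n" by auto
        then show "v' r l 0 * p l 0 - v r l 0 * p' l 0 = v' r l 0 * p 0 0 - v r 0 0 * p' l 0"
          using psi_cont[of l 0] v_cont[of l 0 r] by (simp add: p_def)
      qed
      also have "\<dots> = (\<Sum>l<n. v' r l 0) * p 0 0 - v r 0 0 * (\<Sum>l<n. p' l 0)"
        by (simp only: sum_subtractf sum_distrib_left sum_distrib_right)
      also have "(\<Sum>l<n. p' l 0) = of_real (\<Sum>l<n. psi' l 0)"
        by (simp add: p'_def)
      finally show ?thesis using v_bal psi_bal by simp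
    qed
    have sum_eq: "(\<Sum>l<n. v' r l (a l) / of_real (e r) * p l (a l))
        = (\<Sum>l<n. of_real ((lamf (e r) - 1) / e r) * I1 r l - of_real (e r * k\<^sup>2) * I2 r l)" for r
    proof -
      have ne: "complex_of_real (e r) \<noteq> 0" using e_pos[of r] by simp
      have "(\<Sum>l<n. v' r l (a l) * p l (a l)) = (\<Sum>l<n. v' r l (a l) * p l (a l) - (v' r l 0 * p l 0 - v r l 0 * p' l 0))"
        using bdry[of r] by (simp add: sum_subtractf)
      also have "\<dots> = (\<Sum>l<n. of_real (lamf (e r) - 1) * I1 r l - of_real ((e r)\<^sup>2 * k\<^sup>2) * I2 r l)"
        using green by simp
      finally have "(\<Sum>l<n. v' r l (a l) * p l (a l)) / of_real (e r)
          = (\<Sum>l<n. of_real (lamf (e r) - 1) * I1 r l - of_real ((e r)\<^sup>2 * k\<^sup>2) * I2 r l) / of_real (e r)"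
        by simp
      moreover have "(of_real (lamf (e r) - 1) * I1 r l - of_real ((e r)\<^sup>2 * k\<^sup>2) * I2 r l) / of_real (e r)
          = of_real ((lamf (e r) - 1) / e r) * I1 r l - of_real (e r * k\<^sup>2) * I2 r l" for l
        using ne by (simp add: field_simps power2_eq_square)
      ultimately show ?thesis
        by (simp add: sum_divide_distrib)
    qed
    have "(\<lambda>r. \<Sum>l<n. v' r l (a l) / of_real (e r) * p l (a l)) \<longlonglongrightarrow> (\<Sum>l<n. \<i> * of_real k * (T l - c l) * p l (a l))"
      by (intro tendsto_sum tendsto_mult v'_lim1 tendsto_const) simp
    moreover have "(\<lambda>r. \<Sum>l<n. of_real ((lamf (e r) - 1) / e r) * I1 r l - of_real (e r * k\<^sup>2) * I2 r l)
        \<longlonglongrightarrow> (\<Sum>l<n. of_real lam * integral {0..a l} (\<lambda>s. of_real (Q l s) * w l s * p l s)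
          - of_real (0 * k\<^sup>2) * integral {0..a l} (\<lambda>s. of_real 1 * w l s * p l s))"
      by (intro tendsto_sum tendsto_diff tendsto_mult tendsto_of_real lam2 e tendsto_const I1_lim I2_lim) simp_all
    ultimately have "(\<Sum>l<n. \<i> * of_real k * (T l - c l) * p l (a l))
        = (\<Sum>l<n. of_real lam * integral {0..a l} (\<lambda>s. of_real (Q l s) * w l s * p l s)
          - of_real (0 * k\<^sup>2) * integral {0..a l} (\<lambda>s. of_real 1 * w l s * p l s))"
      unfolding sum_eq by (rule LIMSEQ_unique)
    also have "\<dots> = of_real lam * (\<Sum>l<n. integral {0..a l} (\<lambda>s. of_real (Q l s) * w l s * p l s))"
      by (simp add: sum_distrib_left)
    also have "(\<Sum>l<n. integral {0..a l} (\<lambda>s. of_real (Q l s) * w l s * p l s))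
        = (\<Sum>j<m. of_real (qmat n a Q psi i' j) * (c j + T j))"
      unfolding p_def by (rule qmat_pairing[OF ode_sol_continuous[OF w] w_exp i'])
    finally have rhs: "(\<Sum>l<n. \<i> * of_real k * (T l - c l) * p l (a l))
        = of_real lam * (\<Sum>j<m. of_real (qmat n a Q psi i' j) * (c j + T j))" .
    \<comment> \<open>On the first \<open>m\<close> edges the endpoint values of
      \<open>psi i'\<close> are Kronecker deltas, on the others they are
      \<open>theta\<close>.\<close>
    have "(\<Sum>l<n. \<i> * of_real k * (T l - c l) * p l (a l))
        = (\<Sum>l<m. \<i> * of_real k * (T l - c l) * p l (a l)) + (\<Sum>l\<in>{m..<n}. \<i> * of_real k * (T l - c l) * p l (a l))"
      unfolding lessThan_atLeast0 by (rule sum.atLeastLessThan_concat[OF le0 m_le, symmetric])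
    also have "(\<Sum>l<m. \<i> * of_real k * (T l - c l) * p l (a l)) = (\<Sum>l<m. if l = i' then \<i> * of_real k * (T l - c l) else 0)"
      using psi_norm[OF i'] by (intro sum.cong) (auto simp: p_def)
    also have "\<dots> = \<i> * of_real k * (T i' - c i')"
      using i' by simp
    also have "(\<Sum>l\<in>{m..<n}. \<i> * of_real k * (T l - c l) * p l (a l))
        = (\<Sum>j\<in>{m..<n}. of_real (theta a psi i' j) * (\<i> * of_real k * (T j - c j)))"
      by (intro sum.cong) (simp_all add: p_def theta_def)
    finally show ?thesis
      using rhs by simp
  qed
  show ?thesis
    unfolding Tlim_prop_iff[OF c_def] using T(2) first second by simp
qed

lemma Tlim_cluster:
  assumes e_pos: "\<And>r. e r > 0" and e: "e \<longlonglongrightarrow> 0"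
    and lam1: "(\<lambda>r. lamf (e r)) \<longlonglongrightarrow> 1" and lam2: "(\<lambda>r. (lamf (e r) - 1) / e r) \<longlonglongrightarrow> lam"
    and t: "\<And>r. Teps_prop n a Q lamf (e r) k i (t r)" and k: "k \<noteq> 0" and i: "i < n"
  shows "\<exists>s T. strict_mono s \<and> Tlim_prop n m (theta a psi) (qmat n a Q psi) lam k i T \<and>
    (\<forall>j<n. (\<lambda>r. t (s r) j) \<longlonglongrightarrow> T j)"
proof -
  have "norm (t r j) \<le> 1" if j: "j < n" for r j
  proof -
    have "(cmod (t r j))\<^sup>2 \<le> (\<Sum>j<n. (cmod (t r j))\<^sup>2)"
      by (rule member_le_sum) (use j in auto)
    also have "\<dots> = 1"
      by (rule Teps_unitary[OF t e_pos k i])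
    finally show ?thesis
      by (simp add: power_le_one_iff)
  qed
  then have "bounded (range (\<lambda>r. t r j))" if "j < n" for j
    using that unfolding bounded_iff by auto
  then obtain s l where s: "strict_mono s" and l: "\<And>j. j < n \<Longrightarrow> (\<lambda>r. t (s r) j) \<longlonglongrightarrow> l j"
    using finite_family_convergent_subsequence[of n t] by blast
  \<comment> \<open>The subsequence determines limits only for actual edges;
    \<open>Tlim_prop\<close> demands zero padding beyond them.\<close>
  define T where "T j = (if j < n then l j else 0)" for j
  have T: "(\<lambda>r. t (s r) j) \<longlonglongrightarrow> T j" if "j < n" for j
    using l[OF that] that by (simp add: T_def)
  have "Tlim_prop n m (theta a psi) (qmat n a Q psi) lam k i T"
  proof (rule Tlim_of_limit_point[of "\<lambda>r. e (s r)" lamf lam k i "\<lambda>r. t (s r)"])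
    show "(\<lambda>r. e (s r)) \<longlonglongrightarrow> 0" "(\<lambda>r. lamf (e (s r))) \<longlonglongrightarrow> 1" "(\<lambda>r. (lamf (e (s r)) - 1) / e (s r)) \<longlonglongrightarrow> lam"
      using LIMSEQ_subseq_LIMSEQ[OF e s] LIMSEQ_subseq_LIMSEQ[OF lam1 s] LIMSEQ_subseq_LIMSEQ[OF lam2 s]
      by (simp_all add: o_def)
  qed (use e_pos t T in \<open>simp_all add: T_def\<close>)
  with s T show ?thesis by blast
qed

text \<open>Every sequence of sizes tending to 0 has a subsequence along which the amplitudes
  converge to a solution of the limit problem. As that solution is unique, no sequence can stay away
  from it.\<close>

lemma scattering_convergence:
  assumes lam1: "(lamf \<longlongrightarrow> 1) (at 0)" and lam2: "((\<lambda>e. (lamf e - 1) / e) \<longlongrightarrow> lam) (at 0)"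
    and k: "k > 0" and i: "i < n"
  shows "\<exists>!t. Tlim_prop n m (theta a psi) (qmat n a Q psi) lam k i t"
    and "eps > 0 \<Longrightarrow> \<exists>!t. Teps_prop n a Q lamf eps k i t"
    and "j < n \<Longrightarrow> ((\<lambda>eps. (THE t. Teps_prop n a Q lamf eps k i t) j)
      \<longlongrightarrow> (THE t. Tlim_prop n m (theta a psi) (qmat n a Q psi) lam k i t) j) (at_right 0)"
proof -
  let ?Tlim = "Tlim_prop n m (theta a psi) (qmat n a Q psi) lam k i"
  define \<tau> where "\<tau> e = (THE t. Teps_prop n a Q lamf e k i t)" for e
  have ex1: "\<exists>!t. Teps_prop n a Q lamf e k i t" if "e > 0" for e
    using Teps_exists[OF that k i] Teps_unique[OF _ _ that] k by (metis less_irrefl)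
  have \<tau>: "Teps_prop n a Q lamf e k i (\<tau> e)" if "e > 0" for e
    unfolding \<tau>_def by (rule theI'[OF ex1[OF that]])
  have cluster: "\<exists>s T. strict_mono s \<and> ?Tlim T \<and> (\<forall>j<n. (\<lambda>r. \<tau> (e (s r)) j) \<longlonglongrightarrow> T j)"
    if e: "\<And>r. e r > 0" "e \<longlonglongrightarrow> 0" for e
  proof -
    have "filterlim e (at 0) sequentially"
      unfolding filterlim_at using e by (auto simp: less_imp_neq[symmetric])
    then show ?thesis
      using Tlim_cluster[OF e filterlim_compose[OF lam1] filterlim_compose[OF lam2] \<tau>[OF e(1)] _ i] k
      by blast
  qed
  have unique: "T = T'" if "?Tlim T" "?Tlim T'" for T T'
    using Tlim_unique[OF _ m_le _ that] k by (simp add: qmat_def mult_ac)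
  \<comment> \<open>The sizes \<open>1 / (r + 1)\<close> serve only to produce one limit point, and
    thereby a solution of the limit problem.\<close>
  have lim_ex1: "\<exists>!t. ?Tlim t"
    using cluster[of "\<lambda>r. inverse (real (Suc r))"] LIMSEQ_inverse_real_of_nat unique by auto
  show "\<exists>!t. ?Tlim t" by (rule lim_ex1)
  show "\<exists>!t. Teps_prop n a Q lamf eps k i t" if "eps > 0" by (rule ex1[OF that])
  define T where "T = (THE t. ?Tlim t)"
  have T: "?Tlim T"
    unfolding T_def by (rule theI'[OF lim_ex1])
  have "((\<lambda>e. \<tau> e j) \<longlongrightarrow> T j) (at_right 0)" if j: "j < n"
    unfolding tendsto_at_iff_sequentially
  proof (intro allI impI)
    fix X :: "nat \<Rightarrow> real"
    assume pos: "\<forall>r. X r \<in> {0<..} - {0}" and X: "X \<longlonglongrightarrow> 0"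
    show "((\<lambda>e. \<tau> e j) \<circ> X) \<longlonglongrightarrow> T j"
    proof (rule ccontr)
      assume "\<not> ?thesis"
      then obtain d where d: "d > 0" "\<not> (\<forall>\<^sub>F r in sequentially. dist (\<tau> (X r) j) (T j) < d)"
        unfolding tendsto_iff by auto
      then obtain r :: "nat \<Rightarrow> nat" where r: "strict_mono r" "\<And>x. \<not> dist (\<tau> (X (r x)) j) (T j) < d"
        using not_eventually_sequentiallyD[OF d(2)] by blast
      have "(\<lambda>x. X (r x)) \<longlonglongrightarrow> 0"
        using LIMSEQ_subseq_LIMSEQ[OF X r(1)] by (simp add: o_def)
      then obtain s T' where "?Tlim T'" and "(\<lambda>x. \<tau> (X (r (s x))) j) \<longlonglongrightarrow> T' j"
        using cluster[of "\<lambda>x. X (r x)"] pos j by auto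
      then have "(\<lambda>x. \<tau> (X (r (s x))) j) \<longlonglongrightarrow> T j"
        using unique[OF T] by simp
      then have "\<forall>\<^sub>F x in sequentially. dist (\<tau> (X (r (s x))) j) (T j) < d"
        using d(1) by (rule tendstoD)
      then show False
        using r(2) by (auto simp: eventually_sequentially)
    qed
  qed
  then show "((\<lambda>eps. (THE t. Teps_prop n a Q lamf eps k i t) j) \<longlongrightarrow> (THE t. ?Tlim t) j) (at_right 0)" if "j < n"
    using that unfolding \<tau>_def T_def .
qed

end

text \<open>A remainder of order \<open>e\<^sup>2\<close> is \<open>o(e)\<close>, which gives the
  limit of the quotient; multiplying the quotient by \<open>e\<close> again recovers the limit of
  \<open>lamf\<close>.\<close>

lemma lam_limits:
  assumes "(\<lambda>e. lamf e - 1 - e * lam) \<in> O[at 0](\<lambda>e::real. e\<^sup>2)"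
  shows "((\<lambda>e. (lamf e - 1) / e) \<longlongrightarrow> lam) (at 0)" and "(lamf \<longlongrightarrow> 1) (at 0)"
proof -
  have ne: "\<forall>\<^sub>F e::real in at 0. e \<noteq> 0"
    by (simp add: eventually_at_filter)
  have "((\<lambda>e::real. e\<^sup>2 / e) \<longlongrightarrow> 0) (at 0)"
    by (simp add: power2_eq_square)
  then have "(\<lambda>e::real. e\<^sup>2) \<in> o[at 0](\<lambda>e. e)"
    by (intro smalloI_tendsto ne)
  with assms have "(\<lambda>e. lamf e - 1 - e * lam) \<in> o[at 0](\<lambda>e. e)"
    by (rule landau_o.big_small_trans)
  from tendsto_add[OF smalloD_tendsto[OF this] tendsto_const[of lam]]
  have "((\<lambda>e. (lamf e - 1 - e * lam) / e + lam) \<longlongrightarrow> lam) (at 0)"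
    by simp
  moreover have "\<forall>\<^sub>F e in at 0. (lamf e - 1 - e * lam) / e + lam = (lamf e - 1) / e"
    using ne by eventually_elim (simp add: field_simps)
  ultimately show 1: "((\<lambda>e. (lamf e - 1) / e) \<longlongrightarrow> lam) (at 0)"
    by (rule Lim_transform_eventually)
  have "((\<lambda>e. e * ((lamf e - 1) / e) + 1) \<longlongrightarrow> 0 * lam + 1) (at 0)"
    by (intro tendsto_intros 1)
  moreover have "\<forall>\<^sub>F e in at 0. e * ((lamf e - 1) / e) + 1 = lamf e"
    using ne by eventually_elim simp
  ultimately show "(lamf \<longlongrightarrow> 1) (at 0)"
    using Lim_transform_eventually by fastforce
qed

theorem theorem2:
  fixes n m :: nat
    and a :: "nat \<Rightarrow> real"
    and Q :: "nat \<Rightarrow> real \<Rightarrow> real"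
    and lamf :: "real \<Rightarrow> real" and lam :: real
    and psi :: "nat \<Rightarrow> nat \<Rightarrow> real \<Rightarrow> real"
  assumes a_pos: "\<forall>j<n. a j > 0"
    and Q_meas: "\<forall>j<n. Q j \<in> borel_measurable lborel"
    and Q_bdd: "\<exists>C. \<forall>j<n. \<forall>s. \<bar>Q j s\<bar> \<le> C"
    and Q_supp: "\<forall>j<n. \<forall>s>a j. Q j s = 0"
    and lam_hol: "\<exists>g r. 0 < r \<and> g holomorphic_on ball 0 r \<and>
                    (\<forall>x::real. \<bar>x\<bar> < r \<longrightarrow> g (complex_of_real x) = complex_of_real (lamf x))"
    and lam_exp: "(\<lambda>e. lamf e - 1 - e * lam) \<in> O[at 0](\<lambda>e. e\<^sup>2)"
    and m_le: "m \<le> n"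
    and psi_sol: "\<forall>i<m. solR n a Q (psi i)"
    and psi_span: "\<forall>phi. solR n a Q phi \<longrightarrow>
                    (\<exists>c. \<forall>l<n. \<forall>s\<in>{0..a l}. phi l s = (\<Sum>i<m. c i * psi i l s))"
    and psi_norm: "\<forall>i<m. \<forall>j<m. psi i j (a j) = (if i = j then 1 else 0)"
  shows "\<forall>k>0. \<forall>i<n.
           (\<exists>!t. Tlim_prop n m (theta a psi) (qmat n a Q psi) lam k i t) \<and>
           (\<forall>eps\<in>{0<..1}. \<exists>!t. Teps_prop n a Q lamf eps k i t) \<and>
           (\<forall>j<n. ((\<lambda>eps. (THE t. Teps_prop n a Q lamf eps k i t) j)
                    \<longlongrightarrow> (THE t. Tlim_prop n m (theta a psi) (qmat n a Q psi) lam k i t) j)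
                  (at_right 0))"
proof -
  interpret star_resonance n a Q m psi
  proof
    obtain C where C: "\<forall>j<n. \<forall>s. \<bar>Q j s\<bar> \<le> C"
      using Q_bdd by blast
    show "bounded_potential (Q j)" if "j < n" for j
      using Q_meas C that by (auto simp: bounded_potential_def bounded_iff)
  qed (use a_pos Q_supp m_le psi_sol psi_span psi_norm in blast)+
  show ?thesis
    using scattering_convergence[OF lam_limits(2,1)[OF lam_exp]] by auto
qed

end
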